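(* Let $p$ be a prime and let $(N,+,0,1,|_p)$ be an elementary extension of $(\mathbb{Z},+,0,1,|_p)$. Let $\mathcal{F}$ be the family of all structures with universe $N$ which are $\emptyset$-proper $\emptyset$-expansions of $(N,+,0,1)$. Then $(N,+,0,1,|_p)$ is $\emptyset$-minimal in $\mathcal{F}$; that is, $(N,+,0,1,|_p)\in\mathcal{F}$ and no member of $\mathcal{F}$ is a $\emptyset$-proper $\emptyset$-reduct of $(N,+,0,1,|_p)$.
   Context: $v_p$ is the $p$-adic valuation on $\mathbb{Z}$ and $a\,|_p\,b$ means $v_p(a)\le v_p(b)$. Let $\mathcal{M}_1$ be an $L_1$-structure and $\mathcal{M}_2$ an $L_2$-structure with the same universe $M$, and $A\subseteq M$. $\mathcal{M}_1$ is an $A$-reduct of $\mathcal{M}_2$ (and $\mathcal{M}_2$ an $A$-expansion of $\mathcal{M}_1$) if for every $n\ge1$ every subset of $M^n$ that is $L_1$-definable over $\emptyset$ is $L_2$-definable over $A$. $\mathcal{M}_1$ is an $A$-proper $A$-reduct of $\mathcal{M}_2$ (and $\mathcal{M}_2$ an $A$-proper $A$-expansion of $\mathcal{M}_1$) if $\mathcal{M}_1$ is an $A$-reduct of $\mathcal{M}_2$ but $\mathcal{M}_2$ is not an $A$-reduct of $\mathcal{M}_1$. *)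

theory Defs
  imports "HOL-Computational_Algebra.Primes" "HOL-Library.Extended_Nat"
begin

section \<open>First-order languages and structures\<close>

text \<open>Constant symbols are function symbols of arity 0. The symbols of a language form sets rather
  than whole types, so that a language may have no function or no relation symbols.\<close>

record ('f, 'r) language =
  funs :: "'f set"
  fun_arity :: "'f \<Rightarrow> nat"
  rels :: "'r set"
  rel_arity :: "'r \<Rightarrow> nat"

record ('f, 'r, 'a) struct =
  universe :: "'a set"
  fun_interp :: "'f \<Rightarrow> 'a list \<Rightarrow> 'a"
  rel_interp :: "'r \<Rightarrow> 'a list \<Rightarrow> bool"

definition tuples :: "'a set \<Rightarrow> nat \<Rightarrow> 'a list set" where
  "tuples X n = {xs. length xs = n \<and> set xs \<subseteq> X}"

text \<open>The values of \<^const>\<open>fun_interp\<close> and \<^const>\<open>rel_interp\<close> at symbols outside of the language, or at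
  lists that are not tuples over the universe of the right length, are irrelevant junk.\<close>

definition is_struct :: "('f, 'r) language \<Rightarrow> ('f, 'r, 'a) struct \<Rightarrow> bool" where
  "is_struct L M \<longleftrightarrow> universe M \<noteq> {} \<and>
     (\<forall>f \<in> funs L. \<forall>xs \<in> tuples (universe M) (fun_arity L f). fun_interp M f xs \<in> universe M)"

datatype 'f tm = Var nat | Fun 'f "'f tm list"

datatype ('f, 'r) fm =
    Equal "'f tm" "'f tm"
  | Rel 'r "'f tm list"
  | Neg "('f, 'r) fm"
  | Conj "('f, 'r) fm" "('f, 'r) fm"
  | Exi nat "('f, 'r) fm"

primrec is_tm :: "('f, 'r) language \<Rightarrow> 'f tm \<Rightarrow> bool" where
  "is_tm L (Var i) \<longleftrightarrow> True"
| "is_tm L (Fun f ts) \<longleftrightarrow> f \<in> funs L \<and> length ts = fun_arity L f \<and> list_all (is_tm L) ts"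

primrec is_fm :: "('f, 'r) language \<Rightarrow> ('f, 'r) fm \<Rightarrow> bool" where
  "is_fm L (Equal s t) \<longleftrightarrow> is_tm L s \<and> is_tm L t"
| "is_fm L (Rel r ts) \<longleftrightarrow> r \<in> rels L \<and> length ts = rel_arity L r \<and> list_all (is_tm L) ts"
| "is_fm L (Neg \<phi>) \<longleftrightarrow> is_fm L \<phi>"
| "is_fm L (Conj \<phi> \<psi>) \<longleftrightarrow> is_fm L \<phi> \<and> is_fm L \<psi>"
| "is_fm L (Exi i \<phi>) \<longleftrightarrow> is_fm L \<phi>"

primrec tm_vars :: "'f tm \<Rightarrow> nat set" where
  "tm_vars (Var i) = {i}"
| "tm_vars (Fun f ts) = \<Union> (set (map tm_vars ts))"

primrec free_vars :: "('f, 'r) fm \<Rightarrow> nat set" where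
  "free_vars (Equal s t) = tm_vars s \<union> tm_vars t"
| "free_vars (Rel r ts) = \<Union> (set (map tm_vars ts))"
| "free_vars (Neg \<phi>) = free_vars \<phi>"
| "free_vars (Conj \<phi> \<psi>) = free_vars \<phi> \<union> free_vars \<psi>"
| "free_vars (Exi i \<phi>) = free_vars \<phi> - {i}"

primrec tm_val :: "('f, 'r, 'a) struct \<Rightarrow> (nat \<Rightarrow> 'a) \<Rightarrow> 'f tm \<Rightarrow> 'a" where
  "tm_val M v (Var i) = v i"
| "tm_val M v (Fun f ts) = fun_interp M f (map (tm_val M v) ts)"

primrec sat :: "('f, 'r, 'a) struct \<Rightarrow> (nat \<Rightarrow> 'a) \<Rightarrow> ('f, 'r) fm \<Rightarrow> bool" where
  "sat M v (Equal s t) \<longleftrightarrow> tm_val M v s = tm_val M v t"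
| "sat M v (Rel r ts) \<longleftrightarrow> rel_interp M r (map (tm_val M v) ts)"
| "sat M v (Neg \<phi>) \<longleftrightarrow> \<not> sat M v \<phi>"
| "sat M v (Conj \<phi> \<psi>) \<longleftrightarrow> sat M v \<phi> \<and> sat M v \<psi>"
| "sat M v (Exi i \<phi>) \<longleftrightarrow> (\<exists>a \<in> universe M. sat M (v(i := a)) \<phi>)"

text \<open>An elementary extension of \<open>M\<close> is given by an elementary embedding \<open>e\<close> of \<open>M\<close>, along which \<open>M\<close>
  is identified with its image. (Injectivity of \<open>e\<close> is the case of the formula \<open>x = y\<close>.)\<close>

definition elementary_extension ::
  "('f, 'r) language \<Rightarrow> ('f, 'r, 'b) struct \<Rightarrow> ('b \<Rightarrow> 'a) \<Rightarrow> ('f, 'r, 'a) struct \<Rightarrow> bool" where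
  "elementary_extension L M e N \<longleftrightarrow>
     is_struct L M \<and> is_struct L N \<and> e ` universe M \<subseteq> universe N \<and>
     (\<forall>\<phi> v. is_fm L \<phi> \<longrightarrow> range v \<subseteq> universe M \<longrightarrow> (sat M v \<phi> \<longleftrightarrow> sat N (e \<circ> v) \<phi>))"

section \<open>Definable sets, reducts and expansions\<close>

text \<open>The formula \<open>\<phi>\<close> below is \<open>\<phi>(x\<^sub>0, \<dots>, x\<^sub>n\<^sub>-\<^sub>1, y\<^sub>0, \<dots>, y\<^sub>m\<^sub>-\<^sub>1)\<close>, with parameters \<open>bs\<close> from \<open>A\<close> plugged
  in for the variables \<open>y\<^sub>j\<close>.\<close>

definition definable_over ::
  "('f, 'r) language \<Rightarrow> ('f, 'r, 'a) struct \<Rightarrow> 'a set \<Rightarrow> nat \<Rightarrow> 'a list set \<Rightarrow> bool" where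
  "definable_over L M A n D \<longleftrightarrow>
     (\<exists>\<phi> bs. is_fm L \<phi> \<and> set bs \<subseteq> A \<and> free_vars \<phi> \<subseteq> {..<n + length bs} \<and>
        D = {xs \<in> tuples (universe M) n. sat M (\<lambda>i. (xs @ bs) ! i) \<phi>})"

definition is_reduct ::
  "'a set \<Rightarrow> ('f, 'r) language \<Rightarrow> ('f, 'r, 'a) struct \<Rightarrow> ('g, 's) language \<Rightarrow> ('g, 's, 'a) struct \<Rightarrow> bool" where
  "is_reduct A L\<^sub>1 M\<^sub>1 L\<^sub>2 M\<^sub>2 \<longleftrightarrow>
     is_struct L\<^sub>1 M\<^sub>1 \<and> is_struct L\<^sub>2 M\<^sub>2 \<and> universe M\<^sub>1 = universe M\<^sub>2 \<and> A \<subseteq> universe M\<^sub>1 \<and>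
     (\<forall>n \<ge> 1. \<forall>D \<subseteq> tuples (universe M\<^sub>1) n. definable_over L\<^sub>1 M\<^sub>1 {} n D \<longrightarrow> definable_over L\<^sub>2 M\<^sub>2 A n D)"

definition is_proper_reduct ::
  "'a set \<Rightarrow> ('f, 'r) language \<Rightarrow> ('f, 'r, 'a) struct \<Rightarrow> ('g, 's) language \<Rightarrow> ('g, 's, 'a) struct \<Rightarrow> bool" where
  "is_proper_reduct A L\<^sub>1 M\<^sub>1 L\<^sub>2 M\<^sub>2 \<longleftrightarrow>
     is_reduct A L\<^sub>1 M\<^sub>1 L\<^sub>2 M\<^sub>2 \<and> \<not> is_reduct A L\<^sub>2 M\<^sub>2 L\<^sub>1 M\<^sub>1"

text \<open>The types of the symbols of the expansions are independent of those of \<open>L\<close>, so this constant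
  stands for the family of all expansions in all languages by way of its type instances.\<close>

definition proper_expansions ::
  "'a set \<Rightarrow> ('f, 'r) language \<Rightarrow> ('f, 'r, 'a) struct \<Rightarrow>
     (('g, 's) language \<times> ('g, 's, 'a) struct) set" where
  "proper_expansions A L M = {(L', M'). is_proper_reduct A L M L' M'}"

section \<open>The integers with p-adic divisibility\<close>

definition padic_val :: "nat \<Rightarrow> int \<Rightarrow> enat" where
  "padic_val p a = (if a = 0 then \<infinity> else enat (multiplicity (int p) a))"

datatype group_fun = Plus | Zero | One
datatype padic_rel = PDvd

primrec group_fun_arity :: "group_fun \<Rightarrow> nat" where
  "group_fun_arity Plus = 2"
| "group_fun_arity Zero = 0"
| "group_fun_arity One = 0"

definition padic_language :: "(group_fun, padic_rel) language" where
  "padic_language =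
     \<lparr>funs = UNIV, fun_arity = group_fun_arity, rels = UNIV, rel_arity = (\<lambda>_. 2)\<rparr>"

text \<open>The language \<open>{+, 0, 1}\<close>. A structure for \<^const>\<open>padic_language\<close>, regarded as a structure for this
  language, is its reduct in which \<open>|\<^sub>p\<close> is forgotten.\<close>

definition group_language :: "(group_fun, padic_rel) language" where
  "group_language = padic_language\<lparr>rels := {}\<rparr>"

primrec int_fun_interp :: "group_fun \<Rightarrow> int list \<Rightarrow> int" where
  "int_fun_interp Plus xs = xs ! 0 + xs ! 1"
| "int_fun_interp Zero xs = 0"
| "int_fun_interp One xs = 1"

primrec int_rel_interp :: "nat \<Rightarrow> padic_rel \<Rightarrow> int list \<Rightarrow> bool" where
  "int_rel_interp p PDvd xs \<longleftrightarrow> padic_val p (xs ! 0) \<le> padic_val p (xs ! 1)"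

definition int_padic_struct :: "nat \<Rightarrow> (group_fun, padic_rel, int) struct" where
  "int_padic_struct p =
     \<lparr>universe = UNIV, fun_interp = int_fun_interp, rel_interp = int_rel_interp p\<rparr>"

end

(* By elementarity it suffices to work in the integers. A back-and-forth argument shows that every
predicate definable in (Z,+,0,1,|_p) depends only on finitely many comparisons |_p between affine
forms and on residues modulo some m prime to p. Hence a definable family P(b,x) of subsets of Z is,
outside of finitely many roots of affine forms in b, periodic in x with minimal period d(b)
dividing m p^k, where only k depends on b. If these periods are bounded, P is a Boolean combination
of congruences, linear equations and predicates in fewer variables. If they are unbounded, then
v_p(d(b)) takes all large values, because a unary definable set is eventually periodic, and the
definable subgroups d(b)Z recover |_p. So a structure between (Z,+,0,1) and (Z,+,0,1,|_p) defines
|_p as soon as it defines something new. The relation |_p is not definable in (Z,+,0,1), as it would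
then be definable from |_q for another prime q, but p^nZ has no period m q^k with m fixed. *)

theory Submission
  imports Defs "HOL-Number_Theory.Cong" "HOL-Library.FuncSet"
begin

text \<open>The integers are not saturated, so the back-and-forth cannot extend types. It is graded
  instead: agreement at a larger height and modulus guarantees a one-point extension at the given
  height and modulus, and every quantifier costs a bounded increase of both. An intermediate
  structure lives on N and need not induce anything on the integers. It is replaced by its class of
  definable predicates, pulled back along p-adic formulas, so that the dichotomy is about classes of
  integer predicates closed under first-order operations and no longer about languages. In such a
  class d(b) is no term, but "g is a period of the fibre over b" is a predicate, and it says that
  d(b) divides g. The subgroups d(b)Z have two defects: d(b) may contain a factor prime to p, and
  small valuations may be missing among the d(b). One constant c = m p^k absorbs both: v_p(x) \<le>
  v_p(y) holds iff every d(b) dividing c x divides c y.\<close>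

section \<open>Affine forms and p-adic valuations\<close>

text \<open>One bound for the coefficients and the constant term makes the set finite for finite
  \<open>S\<close>, and puts small constants among the forms, so that comparisons with them need no
  separate treatment.\<close>

definition forms :: "nat set \<Rightarrow> nat \<Rightarrow> ((nat \<Rightarrow> int) \<Rightarrow> int) set" where
  "forms S B = {\<lambda>v. c + (\<Sum>i\<in>S. k i * v i) | k c. (\<forall>i\<in>S. \<bar>k i\<bar> \<le> int B) \<and> \<bar>c\<bar> \<le> int B}"

lemma formsI:
  "(\<forall>i\<in>S. \<bar>k i\<bar> \<le> int B) \<Longrightarrow> \<bar>c\<bar> \<le> int B \<Longrightarrow> (\<lambda>v. c + (\<Sum>i\<in>S. k i * v i)) \<in> forms S B"
  by (auto simp: forms_def)

lemma formsE:
  assumes "f \<in> forms S B"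
  obtains k c where "f = (\<lambda>v. c + (\<Sum>i\<in>S. k i * v i))" "\<forall>i\<in>S. \<bar>k i\<bar> \<le> int B" "\<bar>c\<bar> \<le> int B"
  using assms by (auto simp: forms_def)

lemma forms_mono: "B \<le> C \<Longrightarrow> forms S B \<subseteq> forms S C"
  by (fastforce simp: forms_def)

lemma forms_const: "\<bar>c\<bar> \<le> int B \<Longrightarrow> (\<lambda>v. c) \<in> forms S B"
  using formsI[of S "\<lambda>_. 0" B c] by simp

lemma forms_scale:
  assumes "f \<in> forms S B" "B * nat \<bar>n\<bar> \<le> C"
  shows "(\<lambda>v. n * f v) \<in> forms S C"
proof -
  from assms(1) obtain k c where f: "f = (\<lambda>v. c + (\<Sum>i\<in>S. k i * v i))"
    and k: "\<forall>i\<in>S. \<bar>k i\<bar> \<le> int B" "\<bar>c\<bar> \<le> int B" by (rule formsE)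
  have "int B * \<bar>n\<bar> \<le> int C" using assms(2) by (metis int_nat_eq abs_ge_zero of_nat_mult of_nat_mono)
  then have bd: "\<bar>n * x\<bar> \<le> int C" if "\<bar>x\<bar> \<le> int B" for x
    using mult_right_mono[OF that, of "\<bar>n\<bar>"] by (simp add: abs_mult mult.commute)
  have "(\<lambda>v. n * f v) = (\<lambda>v. n * c + (\<Sum>i\<in>S. (n * k i) * v i))"
    by (simp add: f distrib_left sum_distrib_left mult.assoc)
  then show ?thesis using k bd by (simp add: formsI)
qed

lemma forms_add:
  assumes "f \<in> forms S B" "g \<in> forms S C" "B + C \<le> D"
  shows "(\<lambda>v. f v + g v) \<in> forms S D"
proof -
  from assms(1) obtain k c where f: "f = (\<lambda>v. c + (\<Sum>i\<in>S. k i * v i))"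
    and k: "\<forall>i\<in>S. \<bar>k i\<bar> \<le> int B" "\<bar>c\<bar> \<le> int B" by (rule formsE)
  from assms(2) obtain l d where g: "g = (\<lambda>v. d + (\<Sum>i\<in>S. l i * v i))"
    and l: "\<forall>i\<in>S. \<bar>l i\<bar> \<le> int C" "\<bar>d\<bar> \<le> int C" by (rule formsE)
  have "(\<lambda>v. f v + g v) = (\<lambda>v. (c + d) + (\<Sum>i\<in>S. (k i + l i) * v i))"
    by (simp add: f g distrib_right sum.distrib algebra_simps)
  moreover have "\<forall>i\<in>S. \<bar>k i + l i\<bar> \<le> int D" "\<bar>c + d\<bar> \<le> int D"
    using k l assms(3) by fastforce+
  ultimately show ?thesis by (simp add: formsI)
qed

lemma forms_diff:
  assumes "f \<in> forms S B" "g \<in> forms S C" "B + C \<le> D"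
  shows "(\<lambda>v. f v - g v) \<in> forms S D"
  using forms_add[OF assms(1) forms_scale[OF assms(2), of "-1" C] assms(3)] by simp

lemma finite_forms:
  assumes "finite S"
  shows "finite (forms S B)"
proof -
  have "forms S B \<subseteq> (\<lambda>(k, c) v. c + (\<Sum>i\<in>S. k i * v i)) `
      ((S \<rightarrow>\<^sub>E {-int B..int B}) \<times> {-int B..int B})"
  proof
    fix f assume "f \<in> forms S B"
    then obtain k c where f: "f = (\<lambda>v. c + (\<Sum>i\<in>S. k i * v i))"
      and k: "\<forall>i\<in>S. \<bar>k i\<bar> \<le> int B" "\<bar>c\<bar> \<le> int B" by (rule formsE)
    have "f = (\<lambda>(k, c) v. c + (\<Sum>i\<in>S. k i * v i)) (restrict k S, c)"
      by (simp add: f)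
    moreover have "(restrict k S, c) \<in> (S \<rightarrow>\<^sub>E {-int B..int B}) \<times> {-int B..int B}"
      using k by (auto simp: abs_le_iff; force)
    ultimately show "f \<in> (\<lambda>(k, c) v. c + (\<Sum>i\<in>S. k i * v i)) `
      ((S \<rightarrow>\<^sub>E {-int B..int B}) \<times> {-int B..int B})" by blast
  qed
  then show ?thesis
    by (rule finite_subset) (intro finite_imageI finite_cartesian_product finite_PiE assms; simp)
qed

lemma forms_insertE:
  assumes "f \<in> forms (insert i S) B" "i \<notin> S" "finite S"
  obtains \<alpha> t where "\<bar>\<alpha>\<bar> \<le> int B" "t \<in> forms S B" "f = (\<lambda>v. \<alpha> * v i + t v)"
proof -
  from assms(1) obtain k c where f: "f = (\<lambda>v. c + (\<Sum>j\<in>insert i S. k j * v j))"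
    and k: "\<forall>j\<in>insert i S. \<bar>k j\<bar> \<le> int B" "\<bar>c\<bar> \<le> int B" by (rule formsE)
  have "f = (\<lambda>v. k i * v i + (c + (\<Sum>j\<in>S. k j * v j)))"
    using assms by (simp add: f algebra_simps)
  with k show ?thesis by (intro that[of "k i" "\<lambda>v. c + (\<Sum>j\<in>S. k j * v j)"]) (auto intro: formsI)
qed

lemma forms_depends:
  assumes "f \<in> forms S B" "\<And>i. i \<in> S \<Longrightarrow> v i = w i"
  shows "f v = f w"
  using assms by (auto elim!: formsE intro!: sum.cong)

lemma forms_upd [simp]: "f \<in> forms S B \<Longrightarrow> i \<notin> S \<Longrightarrow> f (v(i := x)) = f v"
  by (erule forms_depends) auto

lemma forms_cong:
  assumes "f \<in> forms S B" "\<And>i. i \<in> S \<Longrightarrow> [v i = w i] (mod m)"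
  shows "[f v = f w] (mod m)"
  using assms by (auto elim!: formsE intro!: cong_add cong_sum cong_mult)

section \<open>Valuation arithmetic for a fixed prime\<close>

locale prime_base =
  fixes p :: nat
  assumes prime_p: "prime p"
begin

abbreviation val :: "int \<Rightarrow> enat" where "val \<equiv> padic_val p"

lemma prime_int_p: "prime (int p)"
  using prime_p by simp

lemma p_gt_1: "1 < int p"
  using prime_gt_1_nat[OF prime_p] by simp

lemma val_0 [simp]: "val 0 = \<infinity>"
  by (simp add: padic_val_def)

lemma val_eq_top_iff [simp]: "val a = \<infinity> \<longleftrightarrow> a = 0"
  by (simp add: padic_val_def)

lemma enat_le_val_iff: "enat n \<le> val a \<longleftrightarrow> int p ^ n dvd a"
proof (cases "a = 0")
  case False
  then have "int p ^ n dvd a \<longleftrightarrow> n \<le> multiplicity (int p) a"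
    using p_gt_1 by (intro power_dvd_iff_le_multiplicity) auto
  with False show ?thesis by (simp add: padic_val_def)
qed simp

lemma val_le_enat_iff: "val a \<le> enat n \<longleftrightarrow> \<not> int p ^ Suc n dvd a"
  using enat_le_val_iff[of "Suc n" a] by (cases "val a") auto

lemma val_le_iff: "val a \<le> val b \<longleftrightarrow> (\<forall>n. int p ^ n dvd a \<longrightarrow> int p ^ n dvd b)"
proof
  assume "\<forall>n. int p ^ n dvd a \<longrightarrow> int p ^ n dvd b"
  then have *: "enat n \<le> val a \<Longrightarrow> enat n \<le> val b" for n by (simp add: enat_le_val_iff)
  show "val a \<le> val b"
  proof (cases "val a")
    case infinity
    then show ?thesis using * by (metis Suc_n_not_le_n enat_ord_code(3) enat_ord_simps(1) order_refl not_enat_eq)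
  qed (use * in auto)
qed (meson enat_le_val_iff order_trans)

lemma val_mult: "val (a * b) = val a + val b"
  using prime_int_p by (auto simp: padic_val_def prime_elem_multiplicity_mult_distrib prime_imp_prime_elem)

lemma val_power [simp]: "val (int p ^ n) = enat n"
  using p_gt_1 by (simp add: padic_val_def multiplicity_same_power)

lemma val_1 [simp]: "val 1 = 0"
  using val_power[of 0] by (simp add: zero_enat_def del: val_power)

lemma val_minus [simp]: "val (- a) = val a"
  by (rule antisym) (auto simp: val_le_iff)

lemma val_coprime: "\<not> int p dvd n \<Longrightarrow> val n = 0"
  using val_le_enat_iff[of n 0] by (simp add: zero_enat_def[symmetric])

lemma val_mult_coprime: "\<not> int p dvd n \<Longrightarrow> val (n * a) = val a"
  by (simp add: val_mult val_coprime)

lemma val_mult_left_mono_iff: "n \<noteq> 0 \<Longrightarrow> val (n * a) \<le> val (n * b) \<longleftrightarrow> val a \<le> val b"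
  by (metis enat_add_left_cancel_le val_mult val_eq_top_iff)

lemma min_val_le_add: "min (val a) (val b) \<le> val (a + b)"
proof (cases "val a \<le> val b")
  case True
  then have "val a \<le> val (a + b)" by (simp add: val_le_iff)
  with True show ?thesis by (simp add: min_def)
next
  case False
  then have "val b \<le> val a" by simp
  then have "val b \<le> val (a + b)" by (simp add: val_le_iff)
  with False show ?thesis by (simp add: min_def)
qed

text \<open>The minimum is exceeded only if \<open>val a = val b\<close>, and then the sum would lie
  strictly above \<open>val a\<close>. Unlike \<open>val_add_neq\<close>, this covers equal
  valuations without cancellation.\<close>

lemma val_add_le: "val (a + b) \<le> val a \<Longrightarrow> val (a + b) = min (val a) (val b)"
  using min_val_le_add[of a b] min_val_le_add[of "a + b" "- a"] by (auto simp: min_def split: if_splits)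

lemma val_add_neq: "val a \<noteq> val b \<Longrightarrow> val (a + b) = min (val a) (val b)"
  using min_val_le_add[of a b] min_val_le_add[of "a + b" "- a"] min_val_le_add[of "a + b" "- b"]
  by (auto simp: min_def split: if_splits)

lemma val_cong:
  assumes "[a = b] (mod int p ^ Suc n)"
  shows "val a \<le> enat n \<longleftrightarrow> val b \<le> enat n"
  using assms by (simp add: val_le_enat_iff cong_dvd_iff)

end

section \<open>Back and forth\<close>

context prime_base
begin

lemma val_cong_eq:
  assumes "[a = b] (mod int p ^ Suc n)" "val b = enat n"
  shows "val a = enat n"
proof -
  have "val a \<le> enat n" using val_cong[OF assms(1)] assms(2) by simp
  moreover have "int p ^ n dvd int p ^ Suc n" by (simp add: le_imp_power_dvd)
  then have "[a = b] (mod int p ^ n)" using assms(1) cong_dvd_modulus by blast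
  then have "enat n \<le> val a" using assms(2) by (simp add: enat_le_val_iff cong_dvd_iff flip: assms(2))
       (metis assms(2) cong_dvd_iff enat_le_val_iff order_refl)
  ultimately show ?thesis by simp
qed

text \<open>After division by \<open>p ^ g\<close> both numbers are units modulo p, and
  \<open>n\<close> is their quotient there. Since \<open>n < p\<close>, passing to the multiple
  costs at most a factor p in the height of a form.\<close>

lemma same_val_imp_cong_multiple:
  assumes "val a = enat g" "val b = enat g"
  obtains n where "0 < n" "n < int p" "[a = n * b] (mod int p ^ Suc g)"
proof -
  obtain x where x: "a = int p ^ g * x" using enat_le_val_iff[of g a] assms by (auto elim: dvdE)
  obtain y where y: "b = int p ^ g * y" using enat_le_val_iff[of g b] assms by (auto elim: dvdE)
  have "\<not> int p ^ Suc g dvd a" "\<not> int p ^ Suc g dvd b"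
    using val_le_enat_iff[of a g] val_le_enat_iff[of b g] assms by auto
  then have ndvd: "\<not> int p dvd x" "\<not> int p dvd y"
    unfolding x y power_Suc2 using p_gt_1 by (auto simp: mult_dvd_mono)
  then have "coprime y (int p)"
    using prime_int_p by (metis coprime_commute prime_imp_coprime)
  then obtain z where z: "[y * z = 1] (mod int p)" using cong_solve_coprime_int by blast
  define n where "n = (x * z) mod int p"
  have "[n * y = (x * z) * y] (mod int p)" by (simp add: n_def cong_def mod_mult_left_eq)
  also have "(x * z) * y = x * (y * z)" by simp
  also have "[x * (y * z) = x * 1] (mod int p)" using z by (intro cong_mult) auto
  finally have *: "[n * y = x] (mod int p)" by simp
  have "n \<noteq> 0" using * ndvd by (auto simp: cong_0_iff cong_sym_eq[of 0])
  moreover have "0 \<le> n" "n < int p" using p_gt_1 by (auto simp: n_def)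
  moreover have "[a = n * b] (mod int p ^ Suc g)"
  proof -
    have "int p dvd x - n * y" using * by (metis cong_iff_dvd_diff cong_sym)
    then have "int p ^ Suc g dvd int p ^ g * (x - n * y)" by (simp add: mult.commute mult_dvd_mono)
    then show ?thesis by (simp add: cong_iff_dvd_diff x y algebra_simps)
  qed
  ultimately show ?thesis using that by force
qed

text \<open>Congruences modulo powers of \<open>p\<close> are omitted, being comparisons of \<open>v i - r\<close> with a constant power of \<open>p\<close>.\<close>

definition sim :: "nat set \<Rightarrow> nat \<Rightarrow> int \<Rightarrow> (nat \<Rightarrow> int) \<Rightarrow> (nat \<Rightarrow> int) \<Rightarrow> bool" where
  "sim S B m a b \<longleftrightarrow> (\<forall>i\<in>S. [a i = b i] (mod m)) \<and>
     (\<forall>f\<in>forms S B. \<forall>g\<in>forms S B. val (f a) \<le> val (g a) \<longleftrightarrow> val (f b) \<le> val (g b))"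

lemma sim_sym: "sim S B m a b \<Longrightarrow> sim S B m b a"
  by (auto simp: sim_def cong_sym)

lemma simD:
  "sim S B m a b \<Longrightarrow> f \<in> forms S B \<Longrightarrow> g \<in> forms S B \<Longrightarrow> val (f a) \<le> val (g a) \<longleftrightarrow> val (f b) \<le> val (g b)"
  by (simp add: sim_def)

text \<open>Vanishing is the comparison \<open>val 0 \<le> val (f a)\<close>, because
  \<open>val 0 = \<infinity>\<close> and 0 is a form.\<close>

lemma sim_zero_iff:
  assumes "sim S B m a b" "f \<in> forms S B"
  shows "f a = 0 \<longleftrightarrow> f b = 0"
  using simD[OF assms(1) forms_const[of 0 B S] assms(2)] by (auto simp: val_eq_top_iff[symmetric] simp del: val_eq_top_iff)

lemma coprime_p_power: "coprime m (int p) \<Longrightarrow> coprime (int p ^ n) m"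
  by (simp add: coprime_commute coprime_power_left_iff)

text \<open>If \<open>val w\<close> is close to \<open>val (u a)\<close>, then \<open>w\<close> agrees to leading order with a multiple of \<open>u a\<close>,
  and \<open>w'\<close> is taken to be the same multiple of \<open>u b\<close>.\<close>

lemma sim_extend_near:
  assumes sim: "sim S (p ^ (2 * E + 2) * C) m a b" and m: "coprime m (int p)" and C: "1 \<le> C"
    and w: "w \<noteq> 0" and u: "u \<in> forms S C" and i: "i \<le> E" and j: "j \<le> E"
    and eq: "val (int p ^ i * w) = val (int p ^ j * u a)"
  shows "\<exists>w'. [w' = w] (mod m) \<and> w' \<noteq> 0 \<and> (\<forall>f\<in>forms S C.
     (val (w + f a) \<le> val w \<longrightarrow> val (w' + f b) \<le> val w') \<and>
     (\<forall>l\<le>E. (val (int p ^ l * w) \<le> val (f a) \<longleftrightarrow> val (int p ^ l * w') \<le> val (f b)) \<and>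
            (val (f a) \<le> val (int p ^ l * w) \<longleftrightarrow> val (f b) \<le> val (int p ^ l * w'))))"
proof -
  let ?D = "p ^ (2 * E + 2) * C"
  have p0: "p > 0" and [simp]: "p \<noteq> 0" and p2: "2 \<le> p" using p_gt_1 by auto
  have pow: "p ^ l * C \<le> ?D" if "l \<le> 2 * E + 2" for l
    using that p2 by (intro mult_right_mono power_increasing) auto
  have scale: "(\<lambda>v. int p ^ l * f v) \<in> forms S ?D" if "f \<in> forms S C" "l \<le> 2 * E + 2" for f l
    using pow[OF that(2)] by (intro forms_scale[OF that(1)]) (simp add: nat_power_eq mult.commute)
  have const: "(\<lambda>v. int p ^ l) \<in> forms S ?D" if "l \<le> 2 * E + 2" for l
    using scale[OF forms_const[of 1 C S] that] C by simp
  have pz: "int p ^ l \<noteq> 0" for l using p0 by simp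
  define d where "d = val (int p ^ j * u a)"
  obtain \<delta> where \<delta>: "d = enat \<delta>" using w by (cases d) (auto simp: d_def simp flip: eq)
  obtain n where n: "0 < n" "n < int p" and ncong: "[int p ^ i * w = n * (int p ^ j * u a)] (mod int p ^ Suc \<delta>)"
    using same_val_imp_cong_multiple eq \<delta> d_def by metis
  have np: "\<not> int p dvd n" using n zdvd_not_zless by blast
  have ua0: "u a \<noteq> 0" using \<delta> by (auto simp: d_def)
  have ub0: "u b \<noteq> 0" using sim_zero_iff[OF sim] scale[OF u, of 0] ua0 by auto
  obtain \<delta>' where \<delta>': "val (int p ^ j * u b) = enat \<delta>'"
    using ub0 by (cases "val (int p ^ j * u b)") auto
  \<comment> \<open>The constant \<open>p ^ i\<close> is a form, so its dividing
    \<open>p ^ j * u a\<close> passes to \<open>b\<close>. This permits the division by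
    \<open>p ^ i\<close> that defines \<open>z\<close>.\<close>
  have "val (int p ^ i) \<le> val (int p ^ j * u a)"
    unfolding eq[symmetric] by (simp add: val_mult)
  then have "val (int p ^ i) \<le> val (int p ^ j * u b)"
    using simD[OF sim const scale[OF u], of i j] i j by simp
  then have i\<delta>: "i \<le> \<delta>'" and "int p ^ i dvd int p ^ j * u b" using \<delta>' by (simp_all flip: enat_le_val_iff)
  then obtain z where z: "n * (int p ^ j * u b) = int p ^ i * z"
    by (metis dvd_def mult.left_commute)
  have valz: "val (int p ^ i * z) = enat \<delta>'"
    by (simp add: z[symmetric] val_mult_coprime[OF np] \<delta>')
  obtain \<gamma> where \<gamma>: "val z = enat \<gamma>" "i + \<gamma> = \<delta>'"
    using valz by (cases "val z") (auto simp: val_mult)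
  \<comment> \<open>Modulo \<open>p ^ Suc \<gamma>\<close> the valuation and the leading digit of
    \<open>w'\<close> are prescribed; the residue modulo \<open>m\<close> is still free, as
    \<open>m\<close> is prime to p.\<close>
  obtain w' where w': "[w' = z] (mod int p ^ Suc \<gamma>)" "[w' = w] (mod m)"
    using binary_chinese_remainder_int[OF coprime_p_power[OF m]] by blast
  have vw': "val w' = enat \<gamma>" using val_cong_eq[OF w'(1) \<gamma>(1)] .
  have viw': "val (int p ^ i * w') = val (int p ^ j * u b)"
    using vw' \<gamma> \<delta>' by (simp add: val_mult)
  have "[int p ^ i * w' = int p ^ i * z] (mod int p ^ i * int p ^ Suc \<gamma>)"
    using w'(1) by (simp add: cong_iff_dvd_diff mult_dvd_mono flip: right_diff_distrib)
  then have wcong: "[int p ^ i * w' = n * (int p ^ j * u b)] (mod int p ^ Suc \<delta>')"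
    by (simp add: z flip: \<gamma>(2)) (simp add: power_add mult.left_commute)
  have lw: "val (int p ^ i * (int p ^ l * w)) = val (int p ^ (l + j) * u a)"
    and lw': "val (int p ^ i * (int p ^ l * w')) = val (int p ^ (l + j) * u b)" for l
    using eq viw' by (simp_all add: val_mult power_add mult.assoc add.assoc add.left_commute)
  show ?thesis
  proof (intro exI[of _ w'] conjI ballI impI allI)
    show "[w' = w] (mod m)" by fact
    show "w' \<noteq> 0" using vw' by auto
  next
    fix f assume f: "f \<in> forms S C" and le: "val (w + f a) \<le> val w"
    have "nat \<bar>n\<bar> \<le> p" using n by simp
    then have "p ^ j * C * nat \<bar>n\<bar> \<le> p ^ E * C * p"
      using j p0 by (intro mult_mono power_increasing) auto
    moreover have "p ^ i * C \<le> p ^ E * C" using i p0 by (simp add: power_increasing)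
    \<comment> \<open>The form to be compared has height at most \<open>p ^ E * C * (p + 1)\<close>,
      and \<open>p + 1 \<le> p ^ 2\<close> leads to the exponent \<open>E + 2\<close>.\<close>
    ultimately have "p ^ j * C * nat \<bar>n\<bar> + p ^ i * C \<le> p ^ E * C * p + p ^ E * C" by (rule add_mono)
    also have "\<dots> = p ^ E * C * (p + 1)" by simp
    also have "\<dots> \<le> p ^ E * C * p ^ 2" using p2 by (intro mult_left_mono) (auto simp: power2_eq_square intro: order_trans[OF _ mult_right_mono[OF p2]])
    also have "\<dots> = p ^ (E + 2) * C" by (simp only: power_add mult_ac)
    also have "\<dots> \<le> ?D" by (rule pow) simp
    finally have bd: "p ^ j * C * nat \<bar>n\<bar> + p ^ i * C \<le> ?D" .
    have "(\<lambda>v. int p ^ l * g v) \<in> forms S (p ^ l * C)" if "g \<in> forms S C" for g l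
      by (intro forms_scale[OF that]) (simp add: nat_power_eq mult.commute)
    then have mem: "(\<lambda>v. n * (int p ^ j * u v) + int p ^ i * f v) \<in> forms S ?D"
      using forms_add[OF forms_scale[of _ S "p ^ j * C" n, OF _ order_refl] _ bd] u f by blast
    have "val (int p ^ i * (w + f a)) \<le> val (int p ^ i * w)"
      using le val_mult_left_mono_iff[OF pz] by blast
    then have "val (int p ^ i * w + int p ^ i * f a) \<le> enat \<delta>"
      using eq \<delta> by (simp add: d_def distrib_left)
    \<comment> \<open>Whether a valuation is at most \<open>\<delta>\<close> depends only on the
      residue modulo \<open>p ^ Suc \<delta>\<close>, so \<open>p ^ i * w\<close> may be replaced by
      the multiple of \<open>u a\<close>.\<close>
    then have "val (n * (int p ^ j * u a) + int p ^ i * f a) \<le> val (int p ^ j * u a)"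
      using val_cong[OF cong_add[OF ncong cong_refl]] \<delta> d_def by simp
    then have "val (n * (int p ^ j * u b) + int p ^ i * f b) \<le> enat \<delta>'"
      using simD[OF sim mem scale[OF u, of j]] j \<delta>' by simp
    then have "val (int p ^ i * w' + int p ^ i * f b) \<le> val (int p ^ i * w')"
      using val_cong[OF cong_add[OF wcong cong_refl]] viw' \<delta>' by simp
    then show "val (w' + f b) \<le> val w'"
      using val_mult_left_mono_iff[OF pz] by (metis distrib_left)
  next
    fix f l assume f: "f \<in> forms S C" and l: "l \<le> E"
    show "val (int p ^ l * w) \<le> val (f a) \<longleftrightarrow> val (int p ^ l * w') \<le> val (f b)"
    proof -
      have "val (int p ^ l * w) \<le> val (f a) \<longleftrightarrow> val (int p ^ (l + j) * u a) \<le> val (int p ^ i * f a)"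
        using val_mult_left_mono_iff[OF pz] by (metis lw)
      also have "\<dots> \<longleftrightarrow> val (int p ^ (l + j) * u b) \<le> val (int p ^ i * f b)"
        using i j l by (intro simD[OF sim scale[OF u] scale[OF f]]) auto
      also have "\<dots> \<longleftrightarrow> val (int p ^ l * w') \<le> val (f b)"
        using val_mult_left_mono_iff[OF pz] by (metis lw')
      finally show ?thesis .
    qed
    show "val (f a) \<le> val (int p ^ l * w) \<longleftrightarrow> val (f b) \<le> val (int p ^ l * w')"
    proof -
      have "val (f a) \<le> val (int p ^ l * w) \<longleftrightarrow> val (int p ^ i * f a) \<le> val (int p ^ (l + j) * u a)"
        using val_mult_left_mono_iff[OF pz] by (metis lw)
      also have "\<dots> \<longleftrightarrow> val (int p ^ i * f b) \<le> val (int p ^ (l + j) * u b)"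
        using i j l by (intro simD[OF sim scale[OF f] scale[OF u]]) auto
      also have "\<dots> \<longleftrightarrow> val (f b) \<le> val (int p ^ l * w')"
        using val_mult_left_mono_iff[OF pz] by (metis lw')
      finally show ?thesis .
    qed
  qed
qed

end

lemma finite_ex_max:
  fixes f :: "'a \<Rightarrow> 'b::linorder"
  assumes "finite A" "A \<noteq> {}"
  obtains x where "x \<in> A" "\<And>y. y \<in> A \<Longrightarrow> f y \<le> f x"
proof -
  have "Max (f ` A) \<in> f ` A" using assms by (intro Max_in) auto
  then obtain x where "x \<in> A" "f x = Max (f ` A)" by auto
  then show ?thesis using assms that by (metis Max_ge finite_imageI imageI)
qed

context prime_base
begin

text \<open>Here \<open>val w'\<close> is put a bounded distance above the value \<open>val (u b)\<close> that corresponds to the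
  largest \<open>val (u a)\<close> below \<open>val w\<close>.\<close>

lemma sim_extend_far:
  assumes sim: "sim S (p ^ (2 * E + 2) * C) m a b" and m: "coprime m (int p)" and C: "1 \<le> C"
    and S: "finite S" and w: "w \<noteq> 0"
    and far: "\<forall>u\<in>forms S C. \<forall>i\<le>E. \<forall>j\<le>E. val (int p ^ i * w) \<noteq> val (int p ^ j * u a)"
  shows "\<exists>w'. [w' = w] (mod m) \<and> w' \<noteq> 0 \<and> (\<forall>f\<in>forms S C.
     (val (w + f a) \<le> val w \<longrightarrow> val (w' + f b) \<le> val w') \<and>
     (\<forall>l\<le>E. (val (int p ^ l * w) \<le> val (f a) \<longleftrightarrow> val (int p ^ l * w') \<le> val (f b)) \<and>
            (val (f a) \<le> val (int p ^ l * w) \<longleftrightarrow> val (f b) \<le> val (int p ^ l * w'))))"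
proof -
  let ?D = "p ^ (2 * E + 2) * C"
  have [simp]: "p \<noteq> 0" and p2: "2 \<le> p" using p_gt_1 by auto
  have pow: "p ^ l * C \<le> ?D" if "l \<le> 2 * E + 2" for l
    using that p2 by (intro mult_right_mono power_increasing) auto
  have scale: "(\<lambda>v. int p ^ l * f v) \<in> forms S ?D" if "f \<in> forms S C" "l \<le> 2 * E + 2" for f l
    using pow[OF that(2)] by (intro forms_scale[OF that(1)]) (simp add: nat_power_eq mult.commute)
  have mem: "f \<in> forms S ?D" if "f \<in> forms S C" for f using scale[OF that, of 0] by simp
  obtain g where g: "val w = enat g" using w by (cases "val w") auto
  define U where "U = {u \<in> forms S C. val (u a) \<le> val w}"
  \<comment> \<open>The form 1 has valuation 0, so some form always lies below
    \<open>w\<close>.\<close>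
  have "(\<lambda>v. 1) \<in> U" using C by (auto simp: U_def intro: forms_const)
  moreover have "finite U" using finite_forms[OF S] by (simp add: U_def)
  ultimately obtain u where u: "u \<in> U" and max: "\<And>v. v \<in> U \<Longrightarrow> val (v a) \<le> val (u a)"
    using finite_ex_max[of U "\<lambda>u. val (u a)"] by blast
  have uf: "u \<in> forms S C" using u by (simp add: U_def)
  obtain h where h: "val (u a) = enat h" using u g by (cases "val (u a)") (auto simp: U_def)
  then have "u b \<noteq> 0" using sim_zero_iff[OF sim mem[OF uf]] by auto
  then obtain k where k: "val (u b) = enat k" by (cases "val (u b)") auto
  have gap: "g > x + E \<or> x > g + E" if "f \<in> forms S C" "val (f a) = enat x" for f x
  proof (rule ccontr)
    assume "\<not> ?thesis"
    then have "g \<le> x \<and> x - g \<le> E \<or> x \<le> g \<and> g - x \<le> E" by linarith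
    then show False
      using far[rule_format, OF that(1), of "x - g" 0] far[rule_format, OF that(1), of 0 "g - x"] that(2) g
      by (auto simp: val_mult)
  qed
  have hg: "h + E < g" using gap[OF uf h] u h g by (auto simp: U_def)
  \<comment> \<open>Forms below \<open>w\<close> have valuation at most \<open>k\<close> at
    \<open>b\<close>. Those above have at least \<open>h + 2 * E + 2\<close> at \<open>a\<close>,
    hence at least \<open>k + 2 * E + 2\<close> at \<open>b\<close>. With
    \<open>k' = k + E + 1\<close>, a factor up to \<open>p ^ E\<close> cannot carry
    \<open>w'\<close> past the upper ones; this is the origin of the exponent
    \<open>2 * E + 2\<close>.\<close>
  define k' where "k' = k + E + 1"
  obtain w' where w': "[w' = int p ^ k'] (mod int p ^ Suc k')" "[w' = w] (mod m)"
    using binary_chinese_remainder_int[OF coprime_p_power[OF m]] by blast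
  have vw': "val w' = enat k'" using val_cong_eq[OF w'(1)] by simp
  have low: "val (f b) \<le> enat k" if f: "f \<in> forms S C" "val (f a) \<le> val w" for f
    using max[of f] f simD[OF sim mem[OF f(1)] mem[OF uf]] k by (simp add: U_def)
  have vp: "val (int p ^ (2 * E + 2) * x) = enat (2 * E + 2) + val x" for x
    by (simp only: val_mult val_power)
  have high: "enat (g + E) < val (f a) \<and> enat (k' + E) < val (f b)"
    if f: "f \<in> forms S C" "\<not> val (f a) \<le> val w" for f
  proof -
    have 1: "enat (g + E) < val (f a)"
      using gap[OF f(1)] f(2) g by (cases "val (f a)") auto
    then have "val (int p ^ (2 * E + 2) * u a) \<le> val (f a)"
      unfolding vp using hg h by (cases "val (f a)") auto
    then have "val (int p ^ (2 * E + 2) * u b) \<le> val (f b)"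
      using simD[OF sim scale[OF uf order_refl] mem[OF f(1)]] by blast
    then have "enat (k' + E) < val (f b)"
      unfolding vp using k by (cases "val (f b)") (auto simp: k'_def)
    with 1 show ?thesis ..
  qed
  have dich: "(\<exists>x y. val (f a) = enat x \<and> x + E < g \<and> val (f b) = enat y \<and> y + E < k') \<or>
      enat (g + E) < val (f a) \<and> enat (k' + E) < val (f b)" if f: "f \<in> forms S C" for f
  proof (cases "val (f a) \<le> val w")
    case True
    then obtain x where x: "val (f a) = enat x" using g by (cases "val (f a)") auto
    moreover obtain y where "val (f b) = enat y" "y \<le> k" using low[OF f True] by (cases "val (f b)") auto
    ultimately show ?thesis using gap[OF f x] True g by (auto simp: k'_def)
  qed (use high[OF f] in simp)
  show ?thesis
  proof (intro exI[of _ w'] conjI ballI impI allI)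
    show "[w' = w] (mod m)" by fact
    show "w' \<noteq> 0" using vw' by auto
  next
    fix f assume f: "f \<in> forms S C"
    have "val w' \<noteq> val (f b)" using dich[OF f] vw' by (cases "val (f b)") auto
    then show "val (w' + f b) \<le> val w'" by (simp add: val_add_neq)
  next
    fix f l assume f: "f \<in> forms S C" and l: "l \<le> E"
    have "val (int p ^ l * w) = enat (l + g)" "val (int p ^ l * w') = enat (l + k')"
      using g vw' by (simp_all add: val_mult)
    then show "val (int p ^ l * w) \<le> val (f a) \<longleftrightarrow> val (int p ^ l * w') \<le> val (f b)"
      and "val (f a) \<le> val (int p ^ l * w) \<longleftrightarrow> val (f b) \<le> val (int p ^ l * w')"
      using dich[OF f] l by (cases "val (f a)"; cases "val (f b)"; auto)+
  qed
qed

lemma sim_extend: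
  assumes sim: "sim S (p ^ (2 * E + 2) * C) m a b" and m: "coprime m (int p)" and C: "1 \<le> C"
    and S: "finite S"
  shows "\<exists>w'. [w' = w] (mod m) \<and> (w' = 0 \<longleftrightarrow> w = 0) \<and> (\<forall>f\<in>forms S C.
     (val (w + f a) \<le> val w \<longrightarrow> val (w' + f b) \<le> val w') \<and>
     (\<forall>l\<le>E. (val (int p ^ l * w) \<le> val (f a) \<longleftrightarrow> val (int p ^ l * w') \<le> val (f b)) \<and>
            (val (f a) \<le> val (int p ^ l * w) \<longleftrightarrow> val (f b) \<le> val (int p ^ l * w'))))"
proof -
  consider "w = 0" | "w \<noteq> 0" "\<exists>u i j. u \<in> forms S C \<and> i \<le> E \<and> j \<le> E \<and> val (int p ^ i * w) = val (int p ^ j * u a)"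
    | "w \<noteq> 0" "\<forall>u\<in>forms S C. \<forall>i\<le>E. \<forall>j\<le>E. val (int p ^ i * w) \<noteq> val (int p ^ j * u a)"
    by blast
  then show ?thesis
  proof cases
    case 1
    have "f a = 0 \<longleftrightarrow> f b = 0" if "f \<in> forms S C" for f
    proof (rule sim_zero_iff[OF sim])
      show "f \<in> forms S (p ^ (2 * E + 2) * C)"
        using that forms_mono[of C "p ^ (2 * E + 2) * C" S] p_gt_1 by (auto simp: le_imp_power_dvd)
    qed
    then show ?thesis using 1 by (intro exI[of _ 0]) auto
  next
    case 2
    then obtain u i j where "u \<in> forms S C" "i \<le> E" "j \<le> E" "val (int p ^ i * w) = val (int p ^ j * u a)" by blast
    from sim_extend_near[OF sim m C 2(1) this] 2(1) show ?thesis by metis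
  next
    case 3
    from sim_extend_far[OF sim m C S 3] 3(1) show ?thesis by metis
  qed
qed

end

context prime_base
begin

lemma val_scale_min: "val (n * x) = min (val (n * u)) (val (n * v))" if "val x = min (val u) (val v)"
  using that by (auto simp: val_mult min_def add_left_mono enat_add_left_cancel_le)

text \<open>Multiplying \<open>c\<close> by \<open>B!\<close> turns all forms with \<open>c\<close> into \<open>y + \<sigma> a\<close>. With \<open>-\<tau> a\<close> the closest to \<open>y\<close> among
  these centers and \<open>w = y + \<tau> a\<close>, all valuations are \<open>min (val w) (val (\<sigma> a - \<tau> a))\<close>.\<close>

lemma sim_back_and_forth:
  assumes S: "finite S" "i \<notin> S" and m: "0 < m" "coprime m (int p)"
  shows "\<exists>B' m'. 0 < m' \<and> coprime m' (int p) \<and>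
    (\<forall>a b c. sim S B' m' a b \<longrightarrow> (\<exists>d. sim (insert i S) B m (a(i := c)) (b(i := d))))"
proof -
  define A where "A = (fact B :: nat)"
  have A_dvd: "\<alpha> dvd int A" if "\<alpha> \<noteq> 0" "\<bar>\<alpha>\<bar> \<le> int B" for \<alpha>
  proof -
    have "nat \<bar>\<alpha>\<bar> dvd A" using that unfolding A_def by (intro dvd_fact) auto
    then have "\<bar>\<alpha>\<bar> dvd int A" by (metis abs_ge_zero int_dvd_int_iff int_nat_eq)
    then show ?thesis by simp
  qed
  have A0: "0 < A" by (simp add: A_def)
  obtain e A' where A': "int A = int p ^ e * A'" "\<not> int p dvd A'"
    using multiplicity_decompose'[of "int A" "int p"] A0 prime_int_p not_prime_unit
    by (metis of_nat_0_less_iff less_irrefl)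
  have A'pos: "0 < A'" using A' A0 p_gt_1 by (metis of_nat_0_less_iff zero_less_mult_pos zero_less_power less_trans zero_less_one)
  have copA': "coprime A' (int p)" using A'(2) prime_int_p by (metis coprime_commute prime_imp_coprime)
  \<comment> \<open>\<open>C\<close> bounds the centers \<open>\<alpha>' * t\<close> with
    \<open>\<bar>\<alpha>'\<bar> \<le> A\<close> and \<open>t\<close> of height \<open>B\<close>,
    and also the constant \<open>p ^ e \<le> A\<close>. \<open>C2\<close> bounds the forms
    \<open>\<nu> * (\<sigma> - \<tau>)\<close> with \<open>\<bar>\<nu>\<bar> \<le> A\<close>. The
    factor \<open>A'\<close> of the modulus will make \<open>y'\<close> divisible by the part of
    \<open>A\<close> prime to p.\<close>
  define C where "C = A * B + A"
  define C2 where "C2 = 2 * A * C"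
  define m' where "m' = m * A'"
  have "1 \<le> C2" using A0 by (simp add: C2_def C_def)
  have CC2: "2 * C \<le> C2" using A0 by (simp add: C2_def)
  have m': "0 < m'" "coprime m' (int p)" using m A'pos copA' by (simp_all add: m'_def)
  have "\<exists>d. sim (insert i S) B m (a(i := c)) (b(i := d))"
    if sim: "sim S (p ^ (2 * A + 2) * C2) m' a b" for a b c
  proof -
    define y where "y = int A * c"
    have "forms S C \<noteq> {}" using forms_const[of 0 C S] by auto
    then obtain \<tau> where \<tau>: "\<tau> \<in> forms S C" and max: "\<And>\<sigma>. \<sigma> \<in> forms S C \<Longrightarrow> val (y + \<sigma> a) \<le> val (y + \<tau> a)"
      using finite_ex_max[OF finite_forms[OF S(1)], of C "\<lambda>\<sigma>. val (y + \<sigma> a)"] by blast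
    define w where "w = y + \<tau> a"
    obtain w' where w'cong: "[w' = w] (mod m')" and w'0: "w' = 0 \<longleftrightarrow> w = 0"
      and w'add: "\<And>f. f \<in> forms S C2 \<Longrightarrow> val (w + f a) \<le> val w \<Longrightarrow> val (w' + f b) \<le> val w'"
      and w'le: "\<And>f l. f \<in> forms S C2 \<Longrightarrow> l \<le> A \<Longrightarrow> val (int p ^ l * w) \<le> val (f a) \<longleftrightarrow> val (int p ^ l * w') \<le> val (f b)"
      and w'ge: "\<And>f l. f \<in> forms S C2 \<Longrightarrow> l \<le> A \<Longrightarrow> val (f a) \<le> val (int p ^ l * w) \<longleftrightarrow> val (f b) \<le> val (int p ^ l * w')"
      using sim_extend[OF sim m'(2) \<open>1 \<le> C2\<close> S(1), of w] by blast
    define y' where "y' = w' - \<tau> b"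
    have D: "(\<lambda>v. \<sigma> v - \<tau> v) \<in> forms S (2 * C)" if "\<sigma> \<in> forms S C" for \<sigma>
      by (rule forms_diff[OF that \<tau>]) simp
    have D2: "(\<lambda>v. \<nu> * (\<sigma> v - \<tau> v)) \<in> forms S C2" if "\<sigma> \<in> forms S C" "\<bar>\<nu>\<bar> \<le> int A" for \<sigma> \<nu>
    proof (rule forms_scale[OF D[OF that(1)]])
      have "nat \<bar>\<nu>\<bar> \<le> A" using that(2) by simp
      then have "2 * C * nat \<bar>\<nu>\<bar> \<le> 2 * C * A" by (rule mult_left_mono) simp
      then show "2 * C * nat \<bar>\<nu>\<bar> \<le> C2" by (simp add: C2_def mult_ac)
    qed
    have mem2: "f \<in> forms S C2" if "f \<in> forms S C" for f
      using that forms_mono[of C C2 S] CC2 by auto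
    have va: "val (y + \<sigma> a) = min (val w) (val (\<sigma> a - \<tau> a))" if "\<sigma> \<in> forms S C" for \<sigma>
      using val_add_le[of w "\<sigma> a - \<tau> a"] max[OF that] by (simp add: w_def)
    have vb: "val (y' + \<sigma> b) = min (val w') (val (\<sigma> b - \<tau> b))" if "\<sigma> \<in> forms S C" for \<sigma>
    proof -
      have "y' + \<sigma> b = w' + (\<sigma> b - \<tau> b)" by (simp add: y'_def)
      moreover have "val (w' + (\<sigma> b - \<tau> b)) \<le> val w'"
        using w'add[OF forms_mono[OF CC2, THEN subsetD, OF D[OF that]]] max[OF that] by (simp add: w_def)
      ultimately show ?thesis using val_add_le by metis
    qed
    \<comment> \<open>Only the p-part of \<open>\<nu>\<close> affects valuations, and
      \<open>l < p ^ l \<le> A\<close> shows that \<open>E = A\<close> suffices in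
      \<open>sim_extend\<close>.\<close>
    have val_nu: "\<exists>l\<le>A. \<forall>x. val (\<nu> * x) = val (int p ^ l * x)" if nz: "\<nu> \<noteq> 0" and bd: "\<bar>\<nu>\<bar> \<le> int A" for \<nu>
    proof -
      obtain l where l: "val \<nu> = enat l" using nz by (cases "val \<nu>") auto
      then have "int p ^ l dvd \<nu>" by (simp flip: enat_le_val_iff)
      then have "int p ^ l \<le> int A" using nz bd dvd_imp_le_int[of \<nu> "int p ^ l"] by linarith
      then have "p ^ l \<le> A" by (simp flip: of_nat_power)
      moreover have "l < p ^ l" using p_gt_1 by (simp add: power_gt_expt)
      ultimately have "l \<le> A" by simp
      then show ?thesis using l by (auto simp: val_mult)
    qed
    have gen: "(val (\<nu> * w) \<le> val (f a) \<longleftrightarrow> val (\<nu> * w') \<le> val (f b)) \<and>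
       (val (f a) \<le> val (\<nu> * w) \<longleftrightarrow> val (f b) \<le> val (\<nu> * w'))"
      if "\<nu> \<noteq> 0" "\<bar>\<nu>\<bar> \<le> int A" "f \<in> forms S C2" for \<nu> f
      using val_nu[OF that(1,2)] w'le[OF that(3)] w'ge[OF that(3)] by metis
    have ww: "val (\<nu> * w) \<le> val (\<mu> * w) \<longleftrightarrow> val (\<nu> * w') \<le> val (\<mu> * w')" for \<nu> \<mu>
      using w'0 val_mult_left_mono_iff[of w \<nu> \<mu>] val_mult_left_mono_iff[of w' \<nu> \<mu>]
      by (cases "w = 0") (simp_all add: mult.commute)
    have ff: "val (f a) \<le> val (g a) \<longleftrightarrow> val (f b) \<le> val (g b)" if "f \<in> forms S C2" "g \<in> forms S C2" for f g
    proof -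
      have "forms S C2 \<subseteq> forms S (p ^ (2 * A + 2) * C2)" using p_gt_1 by (intro forms_mono) simp
      then show ?thesis using that by (intro simD[OF sim]) auto
    qed
    \<comment> \<open>Both sides are minima of the valuation of a multiple of \<open>w\<close> and
      that of a form of height \<open>C2\<close>. A comparison of minima is a Boolean combination of
      comparisons of their entries, each of which has been transferred.\<close>
    have cmp1: "val (\<nu> * (y + \<sigma> a)) \<le> val (\<mu> * (y + \<rho> a)) \<longleftrightarrow> val (\<nu> * (y' + \<sigma> b)) \<le> val (\<mu> * (y' + \<rho> b))"
      if "\<nu> \<noteq> 0" "\<bar>\<nu>\<bar> \<le> int A" "\<mu> \<noteq> 0" "\<bar>\<mu>\<bar> \<le> int A" "\<sigma> \<in> forms S C" "\<rho> \<in> forms S C" for \<nu> \<mu> \<sigma> \<rho>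
      unfolding val_scale_min[OF va[OF that(5)]] val_scale_min[OF va[OF that(6)]]
        val_scale_min[OF vb[OF that(5)]] val_scale_min[OF vb[OF that(6)]]
      using gen[OF that(1,2) D2[OF that(6,4)]] gen[OF that(3,4) D2[OF that(5,2)]] ww[of \<nu> \<mu>]
        ff[OF D2[OF that(5,2)] D2[OF that(6,4)]]
      by (simp add: min_le_iff_disj)
    have cmp2: "val (g a) \<le> val (\<nu> * (y + \<sigma> a)) \<longleftrightarrow> val (g b) \<le> val (\<nu> * (y' + \<sigma> b))"
      and cmp3: "val (\<nu> * (y + \<sigma> a)) \<le> val (g a) \<longleftrightarrow> val (\<nu> * (y' + \<sigma> b)) \<le> val (g b)"
      if "\<nu> \<noteq> 0" "\<bar>\<nu>\<bar> \<le> int A" "\<sigma> \<in> forms S C" "g \<in> forms S C" for \<nu> g \<sigma>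
      unfolding val_scale_min[OF va[OF that(3)]] val_scale_min[OF vb[OF that(3)]]
      using gen[OF that(1,2) mem2[OF that(4)]] ff[OF D2[OF that(3,2)] mem2[OF that(4)]]
        ff[OF mem2[OF that(4)] D2[OF that(3,2)]]
      by (simp_all add: min_le_iff_disj)
    have "[\<tau> a = \<tau> b] (mod m')" using forms_cong[OF \<tau>] sim by (auto simp: sim_def)
    then have ycong: "[y' = y] (mod m')"
      using cong_diff[OF w'cong cong_sym] by (fastforce simp: w_def y'_def)
    \<comment> \<open>To divide \<open>y'\<close> by \<open>A\<close>, divisibility is checked at p
      by a comparison with the constant \<open>p ^ e\<close>, and away from p by the congruence
      modulo \<open>A'\<close>.\<close>
    have "int p ^ e dvd y'"
    proof -
      have "int p ^ e \<le> int A" using A'(1) A0 by (intro zdvd_imp_le) auto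
      also have "int A \<le> int C" by (simp add: C_def)
      finally have "\<bar>int p ^ e\<bar> \<le> int C" by (metis abs_of_nat of_nat_power)
      then have "val (int p ^ e) \<le> val (1 * (y + 0)) \<longleftrightarrow> val (int p ^ e) \<le> val (1 * (y' + 0))"
        using A0 by (intro cmp2[of 1 "\<lambda>_. 0" "\<lambda>_. int p ^ e"] forms_const) auto
      moreover have "int p ^ e dvd y" using A'(1) by (simp add: y_def)
      ultimately show ?thesis by (simp add: enat_le_val_iff)
    qed
    moreover have "A' dvd y'"
    proof -
      have "[y' = y] (mod A')" using ycong cong_dvd_modulus[of y' y m' A'] by (simp add: m'_def)
      then show ?thesis using A'(1) by (simp add: cong_dvd_iff y_def)
    qed
    ultimately have "int A dvd y'" unfolding A'(1) by (intro divides_mult coprime_p_power copA')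
    then obtain d where d: "y' = int A * d" by (auto elim: dvdE)
    have dc: "[d = c] (mod m)"
    proof -
      have "A' * m dvd A' * (int p ^ e * (d - c))"
        using ycong by (simp add: cong_iff_dvd_diff d y_def A'(1) m'_def algebra_simps)
      then have "m dvd int p ^ e * (d - c)" using A'pos by simp
      then show ?thesis using coprime_p_power[OF m(2), of e]
        by (simp add: cong_iff_dvd_diff coprime_dvd_mult_right_iff coprime_commute)
    qed
    \<comment> \<open>With \<open>A = \<alpha> * \<alpha>'\<close>, the identity
      \<open>A * (\<alpha> * c + t) = \<alpha> * (A * c + \<alpha>' * t)\<close> yields the center
      \<open>\<alpha>' * t\<close>. A form without the new variable stays a form in the old
      ones.\<close>
    have lift: "(\<exists>\<nu> \<sigma>. \<nu> \<noteq> 0 \<and> \<bar>\<nu>\<bar> \<le> int A \<and> \<sigma> \<in> forms S C \<and> int A * (\<alpha> * c + t a) = \<nu> * (y + \<sigma> a) \<and>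
          int A * (\<alpha> * d + t b) = \<nu> * (y' + \<sigma> b)) \<or>
        (\<exists>g\<in>forms S C. int A * (\<alpha> * c + t a) = g a \<and> int A * (\<alpha> * d + t b) = g b)"
      if "\<bar>\<alpha>\<bar> \<le> int B" "t \<in> forms S B" for \<alpha> t
    proof (cases "\<alpha> = 0")
      case True
      have "(\<lambda>v. int A * t v) \<in> forms S C"
        by (rule forms_scale[OF that(2)]) (simp add: C_def)
      then show ?thesis using True by (intro disjI2 bexI[of _ "\<lambda>v. int A * t v"]) auto
    next
      case False
      with A_dvd that(1) have "\<alpha> dvd int A" by blast
      then obtain \<alpha>' where \<alpha>': "int A = \<alpha> * \<alpha>'" by (auto elim: dvdE)
      have bds: "\<bar>\<alpha>\<bar> \<le> int A" "\<bar>\<alpha>'\<bar> \<le> int A"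
        using \<alpha>' A0 by (auto intro!: zdvd_imp_le)
      have "(\<lambda>v. \<alpha>' * t v) \<in> forms S C"
      proof (rule forms_scale[OF that(2)])
        have "B * nat \<bar>\<alpha>'\<bar> \<le> B * A" using bds(2) by (intro mult_left_mono) auto
        also have "B * A \<le> C" by (simp add: C_def)
        finally show "B * nat \<bar>\<alpha>'\<bar> \<le> C" .
      qed
      then show ?thesis using False bds(1)
        by (intro disjI1 exI[of _ \<alpha>] exI[of _ "\<lambda>v. \<alpha>' * t v"]) (auto simp: y_def d \<alpha>' algebra_simps)
    qed
    have cancel: "val x \<le> val z \<longleftrightarrow> val (int A * x) \<le> val (int A * z)" for x z
      using A0 by (simp add: val_mult_left_mono_iff)
    have "sim (insert i S) B m (a(i := c)) (b(i := d))"
      unfolding sim_def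
    proof (intro conjI ballI)
      fix j assume "j \<in> insert i S"
      moreover have "[a j = b j] (mod m)" if "j \<in> S"
        using sim that cong_dvd_modulus[of "a j" "b j" m' m] by (auto simp: sim_def m'_def)
      ultimately show "[(a(i := c)) j = (b(i := d)) j] (mod m)" using dc by (auto simp: cong_sym)
    next
      fix f g assume f: "f \<in> forms (insert i S) B" and g: "g \<in> forms (insert i S) B"
      obtain \<alpha> t where \<alpha>: "\<bar>\<alpha>\<bar> \<le> int B" "t \<in> forms S B" "f = (\<lambda>v. \<alpha> * v i + t v)"
        using forms_insertE[OF f S(2,1)] .
      obtain \<beta> s where \<beta>: "\<bar>\<beta>\<bar> \<le> int B" "s \<in> forms S B" "g = (\<lambda>v. \<beta> * v i + s v)"
        using forms_insertE[OF g S(2,1)] .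
      have "val (int A * (\<alpha> * c + t a)) \<le> val (int A * (\<beta> * c + s a)) \<longleftrightarrow>
        val (int A * (\<alpha> * d + t b)) \<le> val (int A * (\<beta> * d + s b))"
        using lift[OF \<alpha>(1,2)] lift[OF \<beta>(1,2)] cmp1 cmp2 cmp3 ff mem2 by (elim disjE exE bexE conjE) simp_all
      then show "val (f (a(i := c))) \<le> val (g (a(i := c))) \<longleftrightarrow> val (f (b(i := d))) \<le> val (g (b(i := d)))"
        using \<alpha> \<beta> S(2) by (simp add: cancel[symmetric])
    qed
    then show ?thesis ..
  qed
  with m' show ?thesis by blast
qed

end

section \<open>Classes of predicates closed under first-order operations\<close>

lemma tm_val_cong: "(\<And>i. i \<in> tm_vars t \<Longrightarrow> v i = w i) \<Longrightarrow> tm_val M v t = tm_val M w t"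
proof (induction t)
  case (Fun f ts)
  have "map (tm_val M v) ts = map (tm_val M w) ts"
    using Fun.prems by (intro map_cong refl Fun.IH) auto
  then show ?case by (simp only: tm_val.simps)
qed simp

lemma sat_cong: "(\<And>i. i \<in> free_vars \<phi> \<Longrightarrow> v i = w i) \<Longrightarrow> sat M v \<phi> = sat M w \<phi>"
proof (induction \<phi> arbitrary: v w)
  case (Equal s t)
  then show ?case using tm_val_cong[of s v w M] tm_val_cong[of t v w M] by simp
next
  case (Rel r ts)
  have "map (tm_val M v) ts = map (tm_val M w) ts"
    using Rel by (intro map_cong refl tm_val_cong) auto
  then show ?case by (simp only: sat.simps)
next
  case (Neg \<phi>)
  from Neg.IH[of v w] Neg.prems show ?case by simp
next
  case (Conj \<phi> \<psi>)
  from Conj.IH[of v w] Conj.prems show ?case by simp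
next
  case (Exi i \<phi>)
  have "sat M (v(i := a)) \<phi> = sat M (w(i := a)) \<phi>" for a
    using Exi.prems by (intro Exi.IH) auto
  then show ?case by simp
qed

lemma finite_tm_vars: "finite (tm_vars t)"
  by (induction t) auto

lemma finite_free_vars: "finite (free_vars \<phi>)"
  by (induction \<phi>) (auto simp: finite_tm_vars)

definition supported :: "'a set \<Rightarrow> nat \<Rightarrow> ((nat \<Rightarrow> 'a) \<Rightarrow> 'b) \<Rightarrow> bool" where
  "supported U n P \<longleftrightarrow> (\<forall>v w. range v \<subseteq> U \<longrightarrow> range w \<subseteq> U \<longrightarrow> (\<forall>i<n. v i = w i) \<longrightarrow> P v = P w)"

lemma supported_mono: "supported U n P \<Longrightarrow> n \<le> k \<Longrightarrow> supported U k P"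
  unfolding supported_def by (meson order_less_le_trans)

lemma range_updI: "range v \<subseteq> U \<Longrightarrow> x \<in> U \<Longrightarrow> range (v(i := x)) \<subseteq> U"
  by auto

lemma supported_upd:
  "supported U n P \<Longrightarrow> n \<le> i \<Longrightarrow> range v \<subseteq> U \<Longrightarrow> x \<in> U \<Longrightarrow> P (v(i := x)) = P v"
  unfolding supported_def by (metis fun_upd_other leD range_updI)

text \<open>A structure enters the dichotomy only through its definable predicates on assignments,
  whatever its language. \<open>on_ext\<close> discards values on assignments that leave
  \<open>U\<close>, and \<open>supp\<close> supplies fresh variables for substitution.\<close>

locale fo_class =
  fixes U :: "'a set" and D :: "((nat \<Rightarrow> 'a) \<Rightarrow> bool) set"
  assumes on_ext: "P \<in> D \<Longrightarrow> (\<And>v. range v \<subseteq> U \<Longrightarrow> P v = Q v) \<Longrightarrow> Q \<in> D"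
    and neg: "P \<in> D \<Longrightarrow> (\<lambda>v. \<not> P v) \<in> D"
    and conj: "P \<in> D \<Longrightarrow> Q \<in> D \<Longrightarrow> (\<lambda>v. P v \<and> Q v) \<in> D"
    and exi: "P \<in> D \<Longrightarrow> (\<lambda>v. \<exists>x\<in>U. P (v(i := x))) \<in> D"
    and eq: "(\<lambda>v. v i = v j) \<in> D"
    and supp: "P \<in> D \<Longrightarrow> \<exists>n. supported U n P"
begin

lemma disj: "P \<in> D \<Longrightarrow> Q \<in> D \<Longrightarrow> (\<lambda>v. P v \<or> Q v) \<in> D"
  using neg[OF conj[OF neg neg]] by simp

lemma imp: "P \<in> D \<Longrightarrow> Q \<in> D \<Longrightarrow> (\<lambda>v. P v \<longrightarrow> Q v) \<in> D"
  using disj[OF neg, of P Q] by simp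

lemma iff: "P \<in> D \<Longrightarrow> Q \<in> D \<Longrightarrow> (\<lambda>v. P v \<longleftrightarrow> Q v) \<in> D"
  by (rule on_ext[OF conj[OF imp[of P Q] imp[of Q P]]]) auto

lemma const: "(\<lambda>v. b) \<in> D"
  by (cases b) (use eq[of 0 0] neg[OF eq[of 0 0]] in simp_all)

lemma finite_disj: "finite F \<Longrightarrow> (\<And>x. x \<in> F \<Longrightarrow> P x \<in> D) \<Longrightarrow> (\<lambda>v. \<exists>x\<in>F. P x v) \<in> D"
proof (induction F rule: finite_induct)
  case (insert x F)
  then show ?case using disj[of "P x" "\<lambda>v. \<exists>x\<in>F. P x v"] by simp
qed (simp add: const)

lemma finite_conj: "finite F \<Longrightarrow> (\<And>x. x \<in> F \<Longrightarrow> P x \<in> D) \<Longrightarrow> (\<lambda>v. \<forall>x\<in>F. P x v) \<in> D"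
proof (induction F rule: finite_induct)
  case (insert x F)
  then show ?case using conj[of "P x" "\<lambda>v. \<forall>x\<in>F. P x v"] by simp
qed (simp add: const)

lemma ex_fresh:
  assumes "(\<lambda>v. Q v (v i)) \<in> D"
    and "\<And>v x y. range v \<subseteq> U \<Longrightarrow> x \<in> U \<Longrightarrow> y \<in> U \<Longrightarrow> Q (v(i := x)) y = Q v y"
  shows "(\<lambda>v. \<exists>x\<in>U. Q v x) \<in> D"
  by (rule on_ext[OF exi[OF assms(1), of i]]) (simp add: assms(2))

lemma all_fresh:
  assumes "(\<lambda>v. Q v (v i)) \<in> D"
    and "\<And>v x y. range v \<subseteq> U \<Longrightarrow> x \<in> U \<Longrightarrow> y \<in> U \<Longrightarrow> Q (v(i := x)) y = Q v y"
  shows "(\<lambda>v. \<forall>x\<in>U. Q v x) \<in> D"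
  using neg[OF ex_fresh[where Q = "\<lambda>v x. \<not> Q v x", OF neg[OF assms(1)]]] assms(2) by simp

text \<open>Substitution is expressed as \<open>\<exists>x. x = v j \<and> P (v(i := x))\<close>.
  For \<open>i = j\<close> the quantifier would capture \<open>j\<close> too, hence the case
  split.\<close>

lemma subst_var:
  assumes "P \<in> D"
  shows "(\<lambda>v. P (v(i := v j))) \<in> D"
proof (cases "i = j")
  case False
  show ?thesis
    by (rule on_ext[OF exi[OF conj[OF eq[of i j] assms], of i]]) (use False in auto)
qed (use assms in simp)

definition dterm :: "((nat \<Rightarrow> 'a) \<Rightarrow> 'a) \<Rightarrow> bool" where
  "dterm f \<longleftrightarrow> (\<forall>v. range v \<subseteq> U \<longrightarrow> f v \<in> U) \<and> (\<forall>j. (\<lambda>v. v j = f v) \<in> D) \<and> (\<exists>n. supported U n f)"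

lemma dterm_var: "dterm (\<lambda>v. v i)"
  unfolding dterm_def supported_def by (auto simp: eq intro!: exI[of _ "Suc i"])

lemma dterm_const: "c \<in> U \<Longrightarrow> (\<And>j. (\<lambda>v. v j = c) \<in> D) \<Longrightarrow> dterm (\<lambda>v. c)"
  by (auto simp: dterm_def supported_def)

lemma subst_term:
  assumes P: "P \<in> D" and f: "dterm f"
  shows "(\<lambda>v. P (v(i := f v))) \<in> D"
proof -
  obtain n where n: "supported U n P" using supp[OF P] by blast
  obtain k where k: "supported U k f" using f by (auto simp: dterm_def)
  \<comment> \<open>The variable \<open>i\<close> may occur in \<open>f\<close>, so the value of
    \<open>f\<close> is first held in a variable beyond \<open>i\<close> and both supports.\<close>
  define j where "j = n + k + i + 1"
  have "(\<lambda>v. \<exists>x\<in>U. x = f v \<and> P (v(i := x))) \<in> D"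
  proof (rule ex_fresh[of _ j])
    show "(\<lambda>v. v j = f v \<and> P (v(i := v j))) \<in> D"
      using f by (intro conj subst_var P) (simp add: dterm_def)
  next
    fix v :: "nat \<Rightarrow> 'a" and x y assume v: "range v \<subseteq> U" "x \<in> U" "y \<in> U"
    have "f (v(j := x)) = f v"
      by (rule supported_upd[OF k _ v(1,2)]) (simp add: j_def)
    moreover have "P ((v(i := y))(j := x)) = P (v(i := y))"
      by (rule supported_upd[OF n]) (use v in \<open>auto simp: j_def\<close>)
    moreover have "(v(j := x))(i := y) = (v(i := y))(j := x)" by (auto simp: j_def)
    ultimately show "(y = f (v(j := x)) \<and> P ((v(j := x))(i := y))) = (y = f v \<and> P (v(i := y)))"
      by simp
  qed
  then show ?thesis by (rule on_ext) (use f in \<open>auto simp: dterm_def\<close>)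
qed

text \<open>The variable that receives \<open>g\<close> lies outside the support of
  \<open>f\<close>, so the second substitution leaves the first intact.\<close>

lemma rel2:
  assumes R: "\<And>i j. (\<lambda>v. R (v i) (v j)) \<in> D" and f: "dterm f" and g: "dterm g"
  shows "(\<lambda>v. R (f v) (g v)) \<in> D"
proof -
  obtain k where k: "supported U k f" using f by (auto simp: dterm_def)
  have "(\<lambda>v. R (f v) (v (Suc k))) \<in> D"
    using subst_term[OF R[of k "Suc k"] f, of k] by simp
  from subst_term[OF this g, of "Suc k"] show ?thesis
  proof (rule on_ext)
    fix v :: "nat \<Rightarrow> 'a" assume v: "range v \<subseteq> U"
    then have "f (v(Suc k := g v)) = f v"
      using g by (intro supported_upd[OF k]) (auto simp: dterm_def)
    then show "R (f (v(Suc k := g v))) ((v(Suc k := g v)) (Suc k)) = R (f v) (g v)" by simp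
  qed
qed

lemma rel3:
  assumes R: "\<And>i j k. (\<lambda>v. R (v i) (v j) (v k)) \<in> D" and f: "dterm f" and g: "dterm g" and h: "dterm h"
  shows "(\<lambda>v. R (f v) (g v) (h v)) \<in> D"
proof -
  obtain n k where n: "supported U n f" and k: "supported U k g" using f g by (auto simp: dterm_def)
  let ?i = "n + k"
  have "(\<lambda>v. R (f v) (g v) (v ?i)) \<in> D"
  proof -
    have "(\<lambda>v. R (f v) (v (Suc ?i)) (v ?i)) \<in> D"
      using subst_term[OF R[of "Suc (Suc ?i)" "Suc ?i" ?i] f, of "Suc (Suc ?i)"] by simp
    from subst_term[OF this g, of "Suc ?i"] show ?thesis
    proof (rule on_ext)
      fix v :: "nat \<Rightarrow> 'a" assume v: "range v \<subseteq> U"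
      then have "f (v(Suc ?i := g v)) = f v"
        using g by (intro supported_upd[OF n]) (auto simp: dterm_def)
      then show "R (f (v(Suc ?i := g v))) ((v(Suc ?i := g v)) (Suc ?i)) ((v(Suc ?i := g v)) ?i) = R (f v) (g v) (v ?i)"
        by simp
    qed
  qed
  from subst_term[OF this h, of ?i] show ?thesis
  proof (rule on_ext)
    fix v :: "nat \<Rightarrow> 'a" assume v: "range v \<subseteq> U"
    then have "f (v(?i := h v)) = f v" "g (v(?i := h v)) = g v"
      using h by (auto simp: dterm_def intro!: supported_upd[OF n] supported_upd[OF k])
    then show "R (f (v(?i := h v))) (g (v(?i := h v))) ((v(?i := h v)) ?i) = R (f v) (g v) (h v)"
      by simp
  qed
qed

lemma dterm_op:
  assumes R: "\<And>i j k. (\<lambda>v. F (v i) (v j) = v k) \<in> D"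
    and U: "\<And>x y. x \<in> U \<Longrightarrow> y \<in> U \<Longrightarrow> F x y \<in> U" and f: "dterm f" and g: "dterm g"
  shows "dterm (\<lambda>v. F (f v) (g v))"
  unfolding dterm_def
proof (intro conjI allI impI)
  obtain n k where n: "supported U n f" and k: "supported U k g" using f g by (auto simp: dterm_def)
  have "supported U (max n k) (\<lambda>v. F (f v) (g v))"
    unfolding supported_def
  proof (intro allI impI)
    fix v w :: "nat \<Rightarrow> 'a"
    assume vw: "range v \<subseteq> U" "range w \<subseteq> U" "\<forall>i<max n k. v i = w i"
    have "f v = f w" using n[unfolded supported_def, rule_format, OF vw(1,2)] vw(3) by simp
    moreover have "g v = g w" using k[unfolded supported_def, rule_format, OF vw(1,2)] vw(3) by simp
    ultimately show "F (f v) (g v) = F (f w) (g w)" by simp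
  qed
  then show "\<exists>n. supported U n (\<lambda>v. F (f v) (g v))" ..
  show "(\<lambda>v. v j = F (f v) (g v)) \<in> D" for j
  proof (rule rel3[of "\<lambda>x y z. z = F x y", OF _ f g dterm_var[of j]])
    show "(\<lambda>v. v k = F (v i) (v j)) \<in> D" for i j k
      by (rule on_ext[OF R[of i j k]]) auto
  qed
next
  fix v :: "nat \<Rightarrow> 'a" assume "range v \<subseteq> U"
  then show "F (f v) (g v) \<in> U" using f g by (simp add: dterm_def U)
qed

text \<open>This will quantify over all parameters of a definable family at once.\<close>

lemma all_vars:
  assumes "finite S" "P \<in> D"
  shows "(\<lambda>v. \<forall>w. range w \<subseteq> U \<longrightarrow> (\<forall>j. j \<notin> S \<longrightarrow> w j = v j) \<longrightarrow> P w) \<in> D"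
  using assms
proof (induction S arbitrary: P rule: finite_induct)
  case empty
  have "w = v" if "\<forall>j. j \<notin> {} \<longrightarrow> w j = v j" for v w :: "nat \<Rightarrow> 'a"
    using that by (intro ext) simp
  then show ?case by (intro on_ext[OF empty.prems]) blast
next
  case (insert i S)
  show ?case
  proof (rule on_ext[OF neg[OF exi[OF neg[OF insert.IH[OF insert.prems]], of i]]], safe)
    fix v w assume v: "range v \<subseteq> U" and w: "range w \<subseteq> U" "\<forall>j. j \<notin> insert i S \<longrightarrow> w j = v j"
      and all: "\<not> (\<exists>x\<in>U. \<not> (\<forall>w. range w \<subseteq> U \<longrightarrow> (\<forall>j. j \<notin> S \<longrightarrow> w j = (v(i := x)) j) \<longrightarrow> P w))"
    from all w(1) have "(\<forall>j. j \<notin> S \<longrightarrow> w j = (v(i := w i)) j) \<longrightarrow> P w" by blast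
    with w(2) show "P w" by auto
  next
    fix v x w assume "range v \<subseteq> U" "x \<in> U" "range w \<subseteq> U" "\<forall>j. j \<notin> S \<longrightarrow> w j = (v(i := x)) j"
      "\<forall>w. range w \<subseteq> U \<longrightarrow> (\<forall>j. j \<notin> insert i S \<longrightarrow> w j = v j) \<longrightarrow> P w"
    then show "P w" by auto
  qed
qed

end

section \<open>Predicates defined by formulas of a structure\<close>

definition formula_predicates :: "('f, 'r) language \<Rightarrow> ('f, 'r, 'a) struct \<Rightarrow> ((nat \<Rightarrow> 'a) \<Rightarrow> bool) set" where
  "formula_predicates L M =
     {P. \<exists>\<phi>. is_fm L \<phi> \<and> (\<forall>v. range v \<subseteq> universe M \<longrightarrow> P v = sat M v \<phi>)}"

lemma formula_predicatesE:
  assumes "P \<in> formula_predicates L M"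
  obtains \<phi> where "is_fm L \<phi>" "\<And>v. range v \<subseteq> universe M \<Longrightarrow> P v = sat M v \<phi>"
  using assms unfolding formula_predicates_def by blast

lemma formula_predicatesI:
  "is_fm L \<phi> \<Longrightarrow> (\<And>v. range v \<subseteq> universe M \<Longrightarrow> P v = sat M v \<phi>) \<Longrightarrow> P \<in> formula_predicates L M"
  unfolding formula_predicates_def by blast

lemma supported_sat: "\<exists>n. supported U n (\<lambda>v. sat M v \<phi>)"
proof -
  obtain n where "\<forall>i\<in>free_vars \<phi>. i < n"
    using finite_free_vars[of \<phi>] finite_nat_set_iff_bounded by blast
  then show ?thesis by (intro exI[of _ n]) (auto simp: supported_def intro!: sat_cong)
qed

lemma fo_class_formula_predicates:
  fixes M :: "('f, 'r, 'a) struct"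
  shows "fo_class (universe M) (formula_predicates L M)"
proof
  fix P Q
  assume "P \<in> formula_predicates L M" "\<And>v. range v \<subseteq> universe M \<Longrightarrow> P v = Q v"
  then show "Q \<in> formula_predicates L M" unfolding formula_predicates_def by auto
next
  fix P assume "P \<in> formula_predicates L M"
  then obtain \<phi> where \<phi>: "is_fm L \<phi>" "\<forall>v. range v \<subseteq> universe M \<longrightarrow> P v = sat M v \<phi>"
    by (auto simp: formula_predicates_def)
  show "(\<lambda>v. \<not> P v) \<in> formula_predicates L M"
    unfolding formula_predicates_def using \<phi> by (intro CollectI exI[of _ "Neg \<phi>"]) auto
  show "(\<lambda>v. \<exists>x\<in>universe M. P (v(i := x))) \<in> formula_predicates L M" for i
    unfolding formula_predicates_def
  proof (intro CollectI exI[of _ "Exi i \<phi>"] conjI allI impI)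
    fix v :: "nat \<Rightarrow> 'a" assume v: "range v \<subseteq> universe M"
    have "P (v(i := x)) = sat M (v(i := x)) \<phi>" if "x \<in> universe M" for x
      using \<phi>(2)[rule_format, OF range_updI[OF v that]] .
    then show "(\<exists>x\<in>universe M. P (v(i := x))) = sat M v (Exi i \<phi>)" by simp
  qed (use \<phi> in simp)
  obtain n where "supported (universe M) n (\<lambda>v. sat M v \<phi>)"
    using supported_sat by blast
  then have "supported (universe M) n P"
    unfolding supported_def using \<phi>(2) by blast
  then show "\<exists>n. supported (universe M) n P" ..
  fix Q assume "Q \<in> formula_predicates L M"
  then obtain \<psi> where "is_fm L \<psi>" "\<forall>v. range v \<subseteq> universe M \<longrightarrow> Q v = sat M v \<psi>"
    by (auto simp: formula_predicates_def)
  then show "(\<lambda>v. P v \<and> Q v) \<in> formula_predicates L M"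
    unfolding formula_predicates_def using \<phi> by (intro CollectI exI[of _ "Conj \<phi> \<psi>"]) auto
next
  show "(\<lambda>v. v i = v j) \<in> formula_predicates L M" for i j
    unfolding formula_predicates_def by (intro CollectI exI[of _ "Equal (Var i) (Var j)"]) auto
qed

text \<open>The induction is used in two ways: it puts all p-adically definable integer predicates
  into \<open>padic_class\<close>, and it shows that an intermediate class containing
  \<open>|_p\<close> contains everything definable from it.\<close>

lemma (in fo_class) sat_mem:
  fixes N :: "(group_fun, padic_rel, 'a) struct"
  assumes N: "is_struct padic_language N" and U: "universe N = U"
    and L: "L = padic_language \<or> L = group_language"
    and plus: "\<And>i j k. (\<lambda>v. fun_interp N Plus [v i, v j] = v k) \<in> D"
    and zero: "\<And>i. (\<lambda>v. v i = fun_interp N Zero []) \<in> D"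
    and one: "\<And>i. (\<lambda>v. v i = fun_interp N One []) \<in> D"
    and dvd: "\<And>i j. L = padic_language \<Longrightarrow> (\<lambda>v. rel_interp N PDvd [v i, v j]) \<in> D"
    and \<phi>: "is_fm L \<phi>"
  shows "(\<lambda>v. sat N v \<phi>) \<in> D"
proof -
  have L': "fun_arity L = group_fun_arity" "rel_arity L = (\<lambda>_. 2)" and rels: "rels group_language = {}"
    using L by (auto simp: padic_language_def group_language_def)
  have closed: "fun_interp N f xs \<in> U" if "length xs = group_fun_arity f" "set xs \<subseteq> U" for f xs
    using N that U by (auto simp: is_struct_def padic_language_def tuples_def)
  have two: "\<exists>s t. ts = [s, t]" if "length ts = 2" for ts :: "group_fun tm list"
    using that by (auto simp: length_Suc_conv numeral_2_eq_2)
  have tm: "dterm (\<lambda>v. tm_val N v t)" if "is_tm L t" for t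
    using that
  proof (induction t)
    case (Fun f ts)
    show ?case
    proof (cases f)
      case Plus
      then have "length ts = 2" using Fun.prems L' by simp
      then obtain s t where st: "ts = [s, t]" using two by blast
      have "dterm (\<lambda>v. tm_val N v s)" "dterm (\<lambda>v. tm_val N v t)"
        using Fun.IH Fun.prems st by simp_all
      then have "dterm (\<lambda>v. fun_interp N Plus [tm_val N v s, tm_val N v t])"
        by (rule dterm_op[of "\<lambda>x y. fun_interp N Plus [x, y]", OF plus, rotated]) (simp add: closed)
      then show ?thesis by (simp add: st Plus)
    next
      case Zero
      then have "ts = []" using Fun.prems L' by simp
      moreover have "dterm (\<lambda>v. fun_interp N Zero [])" by (intro dterm_const zero closed) auto
      ultimately show ?thesis using Zero by simp
    next
      case One
      then have "ts = []" using Fun.prems L' by simp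
      moreover have "dterm (\<lambda>v. fun_interp N One [])" by (intro dterm_const one closed) auto
      ultimately show ?thesis using One by simp
    qed
  qed (simp add: dterm_var)
  show ?thesis
    using \<phi>
  proof (induction \<phi>)
    case (Equal s t)
    then show ?case using rel2[of "(=)", OF eq tm tm] by simp
  next
    case (Rel r ts)
    then have L_eq: "L = padic_language" and "length ts = 2" using L L' rels by auto
    then obtain s t where st: "ts = [s, t]" using two by blast
    have "dterm (\<lambda>v. tm_val N v s)" "dterm (\<lambda>v. tm_val N v t)"
      using Rel.prems by (auto simp: st intro: tm)
    then have "(\<lambda>v. rel_interp N PDvd [tm_val N v s, tm_val N v t]) \<in> D"
      by (rule rel2[of "\<lambda>x y. rel_interp N PDvd [x, y]", OF dvd[OF L_eq]])
    then show ?case by (cases r) (simp add: st)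
  next
    case (Neg \<phi>)
    then show ?case using neg by simp
  next
    case (Conj \<phi> \<psi>)
    then show ?case using conj by simp
  next
    case (Exi i \<phi>)
    then show ?case using exi[of "\<lambda>v. sat N v \<phi>" i] U by simp
  qed
qed

section \<open>Eventual periodicity of definable families\<close>

lemma forms_mono_vars:
  assumes "S \<subseteq> S'" "finite S'" "B \<le> B'"
  shows "forms S B \<subseteq> forms S' B'"
proof
  fix f assume "f \<in> forms S B"
  then obtain k c where f: "f = (\<lambda>v. c + (\<Sum>i\<in>S. k i * v i))"
    and k: "\<forall>i\<in>S. \<bar>k i\<bar> \<le> int B" "\<bar>c\<bar> \<le> int B" by (rule formsE)
  have "(\<Sum>i\<in>S'. (if i \<in> S then k i else 0) * v i) = (\<Sum>i\<in>S. k i * v i)" for v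
    using assms by (intro sum.mono_neutral_cong_right) auto
  then have "f = (\<lambda>v. c + (\<Sum>i\<in>S'. (if i \<in> S then k i else 0) * v i))" by (simp add: f)
  also have "\<dots> \<in> forms S' B'" using k assms(3) by (intro formsI) auto
  finally show "f \<in> forms S' B'" .
qed

lemma forms_var:
  assumes "i \<in> S" "finite S" "1 \<le> B"
  shows "(\<lambda>v. v i) \<in> forms S B"
proof -
  have "(\<Sum>j\<in>S. (if j = i then 1 else 0) * v j) = v i" for v :: "nat \<Rightarrow> int"
    using assms by (simp add: if_distrib[of "\<lambda>x. x * _"] cong: if_cong)
  then have "(\<lambda>v. v i) = (\<lambda>v :: nat \<Rightarrow> int. 0 + (\<Sum>j\<in>S. (if j = i then 1 else 0) * v j))"
    by (intro ext) (simp only: add_0)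
  also have "\<dots> \<in> forms S B" using assms by (intro formsI) auto
  finally show ?thesis .
qed

text \<open>The excluded points are zeros of forms in which \<open>x\<close> really occurs, hence
  \<open>\<alpha> \<noteq> 0\<close>. For each \<open>b\<close> there are finitely many, and away
  from them proportional forms are compared by their coefficients alone.\<close>

definition nonroot :: "nat set \<Rightarrow> nat \<Rightarrow> (nat \<Rightarrow> int) \<Rightarrow> int \<Rightarrow> bool" where
  "nonroot S B b x \<longleftrightarrow> (\<forall>\<alpha>\<in>{- int B..int B} - {0}. \<forall>t\<in>forms S B. \<alpha> * x + t b \<noteq> 0)"

lemma finite_roots:
  assumes "finite S"
  shows "finite {x. \<not> nonroot S B b x}"
proof (rule finite_subset)
  show "{x. \<not> nonroot S B b x} \<subseteq> (\<lambda>(\<alpha>, t). - t b div \<alpha>) ` (({- int B..int B} - {0}) \<times> forms S B)"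
  proof
    fix x assume "x \<in> {x. \<not> nonroot S B b x}"
    then obtain \<alpha> t where 1: "\<alpha> \<in> {- int B..int B} - {0}" "t \<in> forms S B" "\<alpha> * x + t b = 0"
      unfolding nonroot_def mem_Collect_eq by blast
    then have "- t b = \<alpha> * x" by simp
    then have "x = - t b div \<alpha>" using 1 by (metis DiffE nonzero_mult_div_cancel_left singletonI)
    with 1 show "x \<in> (\<lambda>(\<alpha>, t). - t b div \<alpha>) ` (({- int B..int B} - {0}) \<times> forms S B)"
      by force
  qed
qed (use finite_forms[OF assms] in auto)

lemma nonroot_depends: "(\<And>i. i \<in> S \<Longrightarrow> v i = w i) \<Longrightarrow> nonroot S B v x = nonroot S B w x"
  unfolding nonroot_def by (intro ball_cong refl) (simp add: forms_depends[of _ S B v w])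

text \<open>Moves a point off a finite set of roots without changing its residue modulo
  \<open>d\<close>.\<close>

lemma ex_progression_notin:
  assumes "finite (F :: int set)" "d \<noteq> 0"
  shows "\<exists>l. a + d * l \<notin> F"
proof -
  have "infinite (range (\<lambda>l. a + d * l))" using assms(2)
    by (auto dest!: finite_imageD simp: inj_on_def infinite_UNIV_int)
  then have "\<not> range (\<lambda>l. a + d * l) \<subseteq> F" using finite_subset[OF _ assms(1)] by metis
  then show ?thesis by auto
qed

definition depends_on :: "nat set \<Rightarrow> ((nat \<Rightarrow> int) \<Rightarrow> bool) \<Rightarrow> bool" where
  "depends_on S P \<longleftrightarrow> (\<forall>v w. (\<forall>i\<in>S. v i = w i) \<longrightarrow> P v = P w)"

lemma depends_onD: "depends_on S P \<Longrightarrow> (\<And>i. i \<in> S \<Longrightarrow> v i = w i) \<Longrightarrow> P v = P w"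
  unfolding depends_on_def by blast

section \<open>Predicates decided by finitely many comparisons and residues\<close>

context prime_base
begin

lemma sim_mono:
  assumes "sim S' B' m' a b" "S \<subseteq> S'" "finite S'" "B \<le> B'" "m dvd m'"
  shows "sim S B m a b"
  unfolding sim_def
proof (intro conjI ballI)
  show "[a i = b i] (mod m)" if "i \<in> S" for i
    using assms(1,2,5) that cong_dvd_modulus[of "a i" "b i" m' m] by (auto simp: sim_def)
  show "(val (f a) \<le> val (g a)) = (val (f b) \<le> val (g b))" if "f \<in> forms S B" "g \<in> forms S B" for f g
    using that forms_mono_vars[OF assms(2-4)] by (intro simD[OF assms(1)]) auto
qed

lemma sim_depends: "(\<And>i. i \<in> S \<Longrightarrow> a i = b i) \<Longrightarrow> sim S B m a b"
  unfolding sim_def by (auto simp: forms_depends[of _ S B a b])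

text \<open>Invariance under some \<open>sim\<close> takes the place of quantifier elimination: no
  quantifier-free formula is ever built, and closure under \<open>\<exists>\<close> is the
  back-and-forth property.\<close>

definition padic_class :: "((nat \<Rightarrow> int) \<Rightarrow> bool) set" where
  "padic_class = {P. \<exists>S B m. finite S \<and> 0 < m \<and> coprime m (int p) \<and> (\<forall>a b. sim S B m a b \<longrightarrow> P a = P b)}"

lemma padic_classI:
  "finite S \<Longrightarrow> (\<And>a b. sim S B 1 a b \<Longrightarrow> P a = P b) \<Longrightarrow> P \<in> padic_class"
  unfolding padic_class_def by (intro CollectI exI[of _ S] exI[of _ B] exI[of _ 1]) simp

lemma padic_class_val_le: "(\<lambda>v. val (v i) \<le> val (v j)) \<in> padic_class"
proof (rule padic_classI)
  show "(val (a i) \<le> val (a j)) = (val (b i) \<le> val (b j))" if "sim {i, j} 1 1 a b" for a b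
    using simD[OF that forms_var forms_var, of i j] by simp
qed simp

lemma padic_class_form_zero:
  assumes "f \<in> forms S B" "finite S"
  shows "(\<lambda>v. f v = 0) \<in> padic_class"
  by (rule padic_classI[OF assms(2), of B]) (rule sim_zero_iff[OF _ assms(1)])

lemma padic_class_eq: "(\<lambda>v. v i = v j) \<in> padic_class"
  using padic_class_form_zero[OF forms_diff[OF forms_var[of i "{i, j}" 1] forms_var[of j "{i, j}" 1] order_refl]]
  by simp

lemma padic_class_plus: "(\<lambda>v. v i + v j = v k) \<in> padic_class"
  using padic_class_form_zero[OF forms_diff[OF forms_add[OF forms_var[of i "{i, j, k}" 1]
     forms_var[of j "{i, j, k}" 1] order_refl] forms_var[of k "{i, j, k}" 1] order_refl]]
  by simp

lemma padic_class_one: "(\<lambda>v. v i = 1) \<in> padic_class"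
  using padic_class_form_zero[OF forms_diff[OF forms_var[of i "{i}" 1] forms_const[of 1 1] order_refl]]
  by simp

lemma padic_class_exi:
  assumes "P \<in> padic_class"
  shows "(\<lambda>v. \<exists>x. P (v(i := x))) \<in> padic_class"
proof -
  obtain S B m where S: "finite S" and m: "0 < m" "coprime m (int p)"
    and P: "\<And>a b. sim S B m a b \<Longrightarrow> P a = P b"
    using assms by (auto simp: padic_class_def)
  have "finite (S - {i})" "i \<notin> S - {i}" using S by auto
  from sim_back_and_forth[OF this m, of B] obtain B' m' where m': "0 < m'" "coprime m' (int p)"
    and ext: "\<And>a b c. sim (S - {i}) B' m' a b \<Longrightarrow> \<exists>d. sim (insert i (S - {i})) B m (a(i := c)) (b(i := d))"
    by blast
  have "\<exists>d. P (b(i := d))" if s: "sim (S - {i}) B' m' a b" and "P (a(i := c))" for a b c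
  proof -
    obtain d where "sim (insert i (S - {i})) B m (a(i := c)) (b(i := d))" using ext[OF s] by blast
    then have "sim S B m (a(i := c)) (b(i := d))" by (rule sim_mono) (use S in auto)
    then show ?thesis using P that(2) by blast
  qed
  then have "(\<exists>x. P (a(i := x))) = (\<exists>x. P (b(i := x)))" if "sim (S - {i}) B' m' a b" for a b
    using that sim_sym by blast
  then show ?thesis using S m' unfolding padic_class_def by blast
qed

lemma padic_class_conj:
  assumes "P \<in> padic_class" "Q \<in> padic_class"
  shows "(\<lambda>v. P v \<and> Q v) \<in> padic_class"
proof -
  obtain S B m where S: "finite S" and m: "0 < m" "coprime m (int p)"
    and P: "\<And>a b. sim S B m a b \<Longrightarrow> P a = P b"
    using assms(1) by (auto simp: padic_class_def)
  obtain S' B' m' where S': "finite S'" and m': "0 < m'" "coprime m' (int p)"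
    and Q: "\<And>a b. sim S' B' m' a b \<Longrightarrow> Q a = Q b"
    using assms(2) by (auto simp: padic_class_def)
  have "P a = P b \<and> Q a = Q b" if s: "sim (S \<union> S') (max B B') (m * m') a b" for a b
    using P[OF sim_mono[OF s]] Q[OF sim_mono[OF s]] S S' by simp
  moreover have "0 < m * m'" "coprime (m * m') (int p)" "finite (S \<union> S')"
    using m m' S S' by simp_all
  ultimately show ?thesis unfolding padic_class_def by blast
qed

lemma padic_class_supported:
  assumes "P \<in> padic_class"
  shows "\<exists>n. supported UNIV n P"
proof -
  obtain S B m where S: "finite S" and P: "\<And>a b. sim S B m a b \<Longrightarrow> P a = P b"
    using assms by (auto simp: padic_class_def)
  obtain n where "\<forall>i\<in>S. i < n" using S finite_nat_set_iff_bounded by blast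
  then have "supported UNIV n P" unfolding supported_def by (auto intro!: P sim_depends)
  then show ?thesis ..
qed

lemma fo_class_padic_class: "fo_class UNIV padic_class"
proof
  fix P Q :: "(nat \<Rightarrow> int) \<Rightarrow> bool"
  assume P: "P \<in> padic_class"
  show "Q \<in> padic_class" if "\<And>v. range v \<subseteq> UNIV \<Longrightarrow> P v = Q v"
  proof -
    have "P = Q" using that by auto
    then show ?thesis using P by simp
  qed
  show "(\<lambda>v. \<not> P v) \<in> padic_class"
    using P unfolding padic_class_def by (simp add: Not_eq_iff)
  show "(\<lambda>v. \<exists>x\<in>UNIV. P (v(i := x))) \<in> padic_class" for i
    using padic_class_exi[OF P] by simp
qed (simp_all add: padic_class_conj padic_class_eq padic_class_supported)

text \<open>Variables outside \<open>S\<close> may be set to 0, which turns forms over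
  \<open>S'\<close> into forms over \<open>S\<close> of the same height; so the old \<open>B\<close>
  and \<open>m\<close> still work.\<close>

lemma padic_class_trim:
  assumes P: "P \<in> padic_class" and S: "finite S" "depends_on S P"
  shows "\<exists>B m. 0 < m \<and> coprime m (int p) \<and> (\<forall>a b. sim S B m a b \<longrightarrow> P a = P b)"
proof -
  obtain S' B m where S': "finite S'" and m: "0 < m" "coprime m (int p)"
    and P': "\<And>a b. sim S' B m a b \<Longrightarrow> P a = P b"
    using P by (auto simp: padic_class_def)
  have "P a = P b" if sim: "sim S B m a b" for a b
  proof -
    define z where "z v i = (if i \<in> S then v i else 0)" for v :: "nat \<Rightarrow> int" and i
    have "\<exists>g\<in>forms S B. \<forall>v. f (z v) = g v" if f: "f \<in> forms S' B" for f
    proof -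
      obtain k c where f: "f = (\<lambda>v. c + (\<Sum>i\<in>S'. k i * v i))"
        and k: "\<forall>i\<in>S'. \<bar>k i\<bar> \<le> int B" "\<bar>c\<bar> \<le> int B" using f by (rule formsE)
      have "(\<Sum>i\<in>S'. k i * z v i) = (\<Sum>i\<in>S. (if i \<in> S' then k i else 0) * v i)" for v
      proof -
        have "(\<Sum>i\<in>S'. k i * z v i) = (\<Sum>i\<in>S \<inter> S'. k i * v i)"
          using S' by (intro sum.mono_neutral_cong_right) (auto simp: z_def)
        also have "\<dots> = (\<Sum>i\<in>S. (if i \<in> S' then k i else 0) * v i)"
          using S(1) by (intro sum.mono_neutral_cong_left) auto
        finally show ?thesis .
      qed
      then show ?thesis
        by (intro bexI[of _ "\<lambda>v. c + (\<Sum>i\<in>S. (if i \<in> S' then k i else 0) * v i)"] formsI)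
          (use k in \<open>auto simp: f\<close>)
    qed
    then have "val (f (z a)) \<le> val (g (z a)) \<longleftrightarrow> val (f (z b)) \<le> val (g (z b))"
      if "f \<in> forms S' B" "g \<in> forms S' B" for f g
      using that simD[OF sim] by metis
    moreover have "[z a i = z b i] (mod m)" for i
      using sim by (simp add: z_def sim_def)
    ultimately have "sim S' B m (z a) (z b)" by (simp add: sim_def)
    then have "P (z a) = P (z b)" by (rule P')
    then show "P a = P b" using depends_onD[OF S(2), of a "z a"] depends_onD[OF S(2), of b "z b"]
      by (simp add: z_def)
  qed
  with m show ?thesis by blast
qed

text \<open>\<open>p ^ k\<close> cannot divide both \<open>f\<close> and \<open>g\<close>, so
  \<open>val f \<le> val g\<close> forces \<open>val f < k\<close>, and such a comparison can be
  read off modulo \<open>p ^ k\<close>.\<close>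

lemma val_le_transfer:
  assumes "[f = f'] (mod int p ^ k)" "[g = g'] (mod int p ^ k)" "\<not> int p ^ k dvd \<beta> * f - \<alpha> * g"
    and "val f \<le> val g"
  shows "val f' \<le> val g'"
  unfolding val_le_iff
proof (intro allI impI)
  fix n assume n: "int p ^ n dvd f'"
  have fg: "int p ^ j dvd f \<Longrightarrow> int p ^ j dvd g" for j using assms(4) by (simp add: val_le_iff)
  then have "\<not> int p ^ k dvd f" using assms(3) by auto
  then have nk: "\<not> int p ^ k dvd f'" using assms(1) by (simp add: cong_dvd_iff)
  have "n \<le> k"
  proof (rule ccontr)
    assume "\<not> n \<le> k"
    then have "int p ^ k dvd int p ^ n" by (intro le_imp_power_dvd) simp
    then show False using n nk dvd_trans by blast
  qed
  then have "int p ^ n dvd int p ^ k" by (rule le_imp_power_dvd)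
  then have "[f = f'] (mod int p ^ n)" "[g = g'] (mod int p ^ n)"
    using assms(1,2) cong_dvd_modulus by blast+
  then show "int p ^ n dvd g'" using n fg[of n] by (simp add: cong_dvd_iff)
qed

text \<open>The two forms have ratio \<open>\<alpha> : \<beta>\<close> at every \<open>x\<close>, so
  the comparison no longer sees \<open>x\<close>. If just one coefficient is 0, its form is
  identically 0 and has valuation \<open>\<infinity>\<close>.\<close>

lemma val_le_proportional:
  assumes "\<beta> * (\<alpha> * x + t) = \<alpha> * (\<beta> * x + s)" "\<alpha> \<noteq> 0 \<Longrightarrow> \<alpha> * x + t \<noteq> 0" "\<beta> \<noteq> 0 \<Longrightarrow> \<beta> * x + s \<noteq> 0"
    and "\<alpha> \<noteq> 0 \<or> \<beta> \<noteq> 0"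
  shows "val (\<alpha> * x + t) \<le> val (\<beta> * x + s) \<longleftrightarrow> \<beta> = 0 \<or> \<alpha> \<noteq> 0 \<and> val \<alpha> \<le> val \<beta>"
proof (cases "\<alpha> = 0 \<or> \<beta> = 0")
  case True
  then show ?thesis using assms by auto
next
  case False
  then have nz: "\<beta> * x + s \<noteq> 0" using assms by blast
  have "val (\<alpha> * x + t) \<le> val (\<beta> * x + s) \<longleftrightarrow> val (\<beta> * (\<alpha> * x + t)) \<le> val (\<beta> * (\<beta> * x + s))"
    using False by (simp add: val_mult_left_mono_iff)
  also have "\<dots> \<longleftrightarrow> val ((\<beta> * x + s) * \<alpha>) \<le> val ((\<beta> * x + s) * \<beta>)"
    by (simp add: assms(1) mult.commute)
  also have "\<dots> \<longleftrightarrow> val \<alpha> \<le> val \<beta>" using nz by (rule val_mult_left_mono_iff)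
  finally show ?thesis using False by simp
qed

lemma eventually_periodic:
  assumes P: "\<And>a b. sim (insert i S) B m a b \<Longrightarrow> P a = P b" and S: "finite S" "i \<notin> S"
  shows "\<exists>k. \<forall>x x'. nonroot S B b x \<longrightarrow> nonroot S B b x' \<longrightarrow> [x = x'] (mod m * int p ^ k) \<longrightarrow>
    P (b(i := x)) = P (b(i := x'))"
proof -
  define I where "I = {- int B..int B}"
  \<comment> \<open>\<open>R\<close> holds the absolute values of the determinants of pairs of forms
    at \<open>b\<close>. A determinant vanishes for proportional forms; any other is smaller than
    \<open>p ^ k\<close> in absolute value, hence not divisible by it. As \<open>R\<close> depends
    on \<open>b\<close>, so does \<open>k\<close>.\<close>
  define R where "R = (\<lambda>(\<alpha>, t, \<beta>, s). \<bar>\<beta> * t b - \<alpha> * s b\<bar>) ` (I \<times> forms S B \<times> I \<times> forms S B)"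
  have "finite R" unfolding R_def I_def using finite_forms[OF S(1)] by blast
  define k where "k = nat (Max R)"
  have small: "\<not> int p ^ k dvd \<beta> * t b - \<alpha> * s b"
    if "\<alpha> \<in> I" "\<beta> \<in> I" "t \<in> forms S B" "s \<in> forms S B" "\<beta> * t b - \<alpha> * s b \<noteq> 0" for \<alpha> \<beta> t s
  proof
    assume "int p ^ k dvd \<beta> * t b - \<alpha> * s b"
    then have "int p ^ k \<le> \<bar>\<beta> * t b - \<alpha> * s b\<bar>" using that(5) dvd_imp_le_int[of "\<beta> * t b - \<alpha> * s b" "int p ^ k"] by simp
    also have "\<dots> \<le> Max R"
    proof (rule Max_ge[OF \<open>finite R\<close>])
      show "\<bar>\<beta> * t b - \<alpha> * s b\<bar> \<in> R"
        unfolding R_def by (rule image_eqI[of _ _ "(\<alpha>, t, \<beta>, s)"]) (use that in simp_all)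
    qed
    also have "\<dots> \<le> int k" by (simp add: k_def)
    also have "\<dots> < int p ^ k" using power_gt_expt[of p k] p_gt_1 by (simp flip: of_nat_power)
    finally show False by simp
  qed
  have transfer: "val (f (b(i := x'))) \<le> val (g (b(i := x')))"
    if x: "nonroot S B b x" "nonroot S B b x'" "[x = x'] (mod m * int p ^ k)"
      and f: "f \<in> forms (insert i S) B" and g: "g \<in> forms (insert i S) B"
      and le: "val (f (b(i := x))) \<le> val (g (b(i := x)))" for x x' f g
  proof -
    obtain \<alpha> t where \<alpha>: "\<bar>\<alpha>\<bar> \<le> int B" "t \<in> forms S B" "f = (\<lambda>v. \<alpha> * v i + t v)"
      using forms_insertE[OF f S(2,1)] .
    obtain \<beta> s where \<beta>: "\<bar>\<beta>\<bar> \<le> int B" "s \<in> forms S B" "g = (\<lambda>v. \<beta> * v i + s v)"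
      using forms_insertE[OF g S(2,1)] .
    have I: "\<alpha> \<in> I" "\<beta> \<in> I" using \<alpha>(1) \<beta>(1) by (auto simp: I_def)
    have le': "val (\<alpha> * x + t b) \<le> val (\<beta> * x + s b)" using le \<alpha> \<beta> S by simp
    have xx': "[x = x'] (mod int p ^ k)" using x(3) cong_dvd_modulus[of x x' "m * int p ^ k" "int p ^ k"] by simp
    have "val (\<alpha> * x' + t b) \<le> val (\<beta> * x' + s b)"
    proof (cases "\<beta> * t b - \<alpha> * s b = 0")
      case False
      have "\<beta> * (\<alpha> * x + t b) - \<alpha> * (\<beta> * x + s b) = \<beta> * t b - \<alpha> * s b" by (simp add: algebra_simps)
      then have "\<not> int p ^ k dvd \<beta> * (\<alpha> * x + t b) - \<alpha> * (\<beta> * x + s b)"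
        using small[OF I \<alpha>(2) \<beta>(2) False] by simp
      then show ?thesis
        by (rule val_le_transfer[rotated 2, OF _ le']) (auto intro!: cong_add cong_mult xx')
    next
      case True
      have nz: "\<alpha> \<noteq> 0 \<Longrightarrow> \<alpha> * z + t b \<noteq> 0" "\<beta> \<noteq> 0 \<Longrightarrow> \<beta> * z + s b \<noteq> 0" if "nonroot S B b z" for z
        using that I \<alpha>(2) \<beta>(2) by (auto simp: nonroot_def I_def)
      have eq: "\<beta> * (\<alpha> * z + t b) = \<alpha> * (\<beta> * z + s b)" for z using True by (simp add: algebra_simps)
      show ?thesis
      proof (cases "\<alpha> = 0 \<and> \<beta> = 0")
        case False
        then have ab: "\<alpha> \<noteq> 0 \<or> \<beta> \<noteq> 0" by blast
        show ?thesis
          using le' val_le_proportional[OF eq nz[OF x(1)] ab] val_le_proportional[OF eq nz[OF x(2)] ab]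
          by simp
      qed (use le' in simp)
    qed
    then show ?thesis using \<alpha> \<beta> S by simp
  qed
  have "P (b(i := x)) = P (b(i := x'))"
    if x: "nonroot S B b x" "nonroot S B b x'" "[x = x'] (mod m * int p ^ k)" for x x'
  proof (rule P, unfold sim_def, intro conjI ballI)
    fix j assume "j \<in> insert i S"
    have "[x = x'] (mod m)" using x(3) cong_dvd_modulus[of x x' "m * int p ^ k" m] by simp
    then show "[(b(i := x)) j = (b(i := x')) j] (mod m)" by simp
  next
    fix f g assume "f \<in> forms (insert i S) B" "g \<in> forms (insert i S) B"
    then show "(val (f (b(i := x))) \<le> val (g (b(i := x)))) = (val (f (b(i := x'))) \<le> val (g (b(i := x'))))"
      using transfer[OF x] transfer[OF x(2,1) cong_sym[OF x(3)]] by blast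
  qed
  then show ?thesis by blast
qed

end

section \<open>Expansions of the group of integers\<close>

lemma subgroup_int:
  assumes "n \<in> H" "n \<noteq> (0::int)" and add: "\<And>g h. g \<in> H \<Longrightarrow> h \<in> H \<Longrightarrow> g + h \<in> H"
    and uminus: "\<And>g. g \<in> H \<Longrightarrow> - g \<in> H"
  obtains d where "0 < d" "\<And>g. g \<in> H \<longleftrightarrow> d dvd g"
proof -
  have zero: "0 \<in> H" using add[OF assms(1) uminus[OF assms(1)]] by simp
  have nat_mult: "int k * g \<in> H" if "g \<in> H" for k g
    by (induction k) (use that add zero in \<open>simp_all add: distrib_right\<close>)
  have mult: "k * g \<in> H" if "g \<in> H" for k g
    using nat_mult[OF that, of "nat \<bar>k\<bar>"] uminus[of "\<bar>k\<bar> * g"] by (cases "0 \<le> k") auto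
  define k where "k = (LEAST k. 0 < k \<and> int k \<in> H)"
  have "0 < nat \<bar>n\<bar> \<and> int (nat \<bar>n\<bar>) \<in> H" using assms(1,2) uminus by (auto simp: abs_if)
  then have k: "0 < k" "int k \<in> H" unfolding k_def by (metis (mono_tags, lifting) LeastI)+
  have "int k dvd g" if "g \<in> H" for g
  proof (rule ccontr)
    assume "\<not> int k dvd g"
    then have "g mod int k \<noteq> 0" by (simp add: dvd_eq_mod_eq_0)
    moreover have less: "0 \<le> g mod int k" "g mod int k < int k" using k(1) by simp_all
    moreover have "g + - (g div int k) * int k = g mod int k"
      using minus_div_mult_eq_mod[of g "int k"] by simp
    then have "g mod int k \<in> H" using add[OF that mult[OF k(2), of "- (g div int k)"]] by simp
    ultimately have "0 < nat (g mod int k) \<and> int (nat (g mod int k)) \<in> H" by simp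
    then have "k \<le> nat (g mod int k)" unfolding k_def by (rule Least_le)
    with less show False by linarith
  qed
  moreover have "g \<in> H" if "int k dvd g" for g
    using that mult[OF k(2)] by (auto simp: mult.commute)
  ultimately show ?thesis using that[of "int k"] k(1) by auto
qed

text \<open>The periods off \<open>F\<close> form a subgroup, but closure under addition is not
  immediate: the intermediate point \<open>x + g\<close> may lie in \<open>F\<close>. A shift by a
  multiple of the known period \<open>n\<close> brings all points involved out of
  \<open>F\<close>.\<close>

lemma periods_modulus:
  fixes Q :: "int \<Rightarrow> bool"
  assumes F: "finite F" and n: "n \<noteq> 0"
    and Q: "\<And>x x'. x \<notin> F \<Longrightarrow> x' \<notin> F \<Longrightarrow> [x = x'] (mod n) \<Longrightarrow> Q x = Q x'"
  obtains d where "0 < d" "d dvd n"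
    "\<And>g. (\<forall>x. x \<notin> F \<longrightarrow> x + g \<notin> F \<longrightarrow> Q (x + g) = Q x) \<longleftrightarrow> d dvd g"
proof -
  define H where "H = {g. \<forall>x. x \<notin> F \<longrightarrow> x + g \<notin> F \<longrightarrow> Q (x + g) = Q x}"
  have nH: "n \<in> H" unfolding H_def by (intro CollectI allI impI Q) (simp_all add: cong_def)
  have "- g \<in> H" if "g \<in> H" for g
    unfolding H_def
  proof (intro CollectI allI impI)
    fix x assume "x \<notin> F" "x + - g \<notin> F"
    then have "Q (x + - g + g) = Q (x + - g)"
      using that[unfolded H_def, THEN CollectD, rule_format, of "x + - g"] by simp
    then show "Q (x + - g) = Q x" by simp
  qed
  moreover have "g + h \<in> H" if g: "g \<in> H" and h: "h \<in> H" for g h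
    unfolding H_def
  proof (intro CollectI allI impI)
    fix x assume x: "x \<notin> F" "x + (g + h) \<notin> F"
    have "finite (F \<union> (\<lambda>y. y - g) ` F \<union> (\<lambda>y. y - (g + h)) ` F)" using F by simp
    from ex_progression_notin[OF this n, of x] obtain l
      where l: "x + n * l \<notin> F \<union> (\<lambda>y. y - g) ` F \<union> (\<lambda>y. y - (g + h)) ` F" by blast
    define z where "z = x + n * l"
    have z: "z \<notin> F" "z + g \<notin> F" "z + g + h \<notin> F"
      using l unfolding z_def[symmetric] by (force simp: image_iff algebra_simps)+
    have "Q x = Q z" by (rule Q[OF x(1) z(1)]) (simp add: z_def cong_iff_dvd_diff)
    also have "Q z = Q (z + g)" using g z by (simp add: H_def)
    also have "\<dots> = Q (z + g + h)" using h z by (simp add: H_def)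
    also have "\<dots> = Q (x + (g + h))"
      by (rule Q[OF z(3) x(2)]) (simp add: z_def cong_iff_dvd_diff)
    finally show "Q (x + (g + h)) = Q x" by simp
  qed
  ultimately obtain d where d: "0 < d" "\<And>g. g \<in> H \<longleftrightarrow> d dvd g"
    using subgroup_int[OF nH n] by metis
  moreover have "d dvd n" using d nH by blast
  ultimately show ?thesis using that[of d] by (auto simp: H_def)
qed

section \<open>Terms and congruences definable from addition and 1\<close>

locale group_class = fo_class "UNIV :: int set" C for C +
  assumes plus: "(\<lambda>v. v i + v j = v k) \<in> C"
    and one: "(\<lambda>v. v i = 1) \<in> C"
begin

lemma ex_int:
  assumes "(\<lambda>v. Q v (v i)) \<in> C" and "\<And>v x y. Q (v(i := x)) y = Q v y"
  shows "(\<lambda>v. \<exists>x. Q v x) \<in> C"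
  using ex_fresh[where Q = Q, OF assms(1)] assms(2) by simp

lemma all_int:
  assumes "(\<lambda>v. Q v (v i)) \<in> C" and "\<And>v x y. Q (v(i := x)) y = Q v y"
  shows "(\<lambda>v. \<forall>x. Q v x) \<in> C"
  using all_fresh[where Q = Q, OF assms(1)] assms(2) by simp

lemma all_vars_int:
  assumes "finite S" "P \<in> C"
  shows "(\<lambda>v. \<forall>w. (\<forall>j. j \<notin> S \<longrightarrow> w j = v j) \<longrightarrow> P w) \<in> C"
  using all_vars[OF assms] by simp

lemma dterm_add: "dterm f \<Longrightarrow> dterm g \<Longrightarrow> dterm (\<lambda>v. f v + g v)"
  by (rule dterm_op[of "(+)", OF plus]) auto

lemma dterm_zero: "dterm (\<lambda>v. 0)"
proof (rule dterm_const)
  show "(\<lambda>v. v j = 0) \<in> C" for j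
    by (rule on_ext[OF plus[of j j j]]) simp
qed simp

lemma eq_terms: "dterm f \<Longrightarrow> dterm g \<Longrightarrow> (\<lambda>v. f v = g v) \<in> C"
  by (rule rel2[of "(=)", OF eq])

lemma dterm_uminus:
  assumes "dterm f"
  shows "dterm (\<lambda>v. - f v)"
  unfolding dterm_def
proof (intro conjI allI impI)
  show "(\<lambda>v. v j = - f v) \<in> C" for j
    using eq_terms[OF dterm_add[OF dterm_var[of j] assms] dterm_zero]
    by (rule on_ext) (simp add: eq_neg_iff_add_eq_0)
  obtain n where "supported UNIV n f" using assms by (auto simp: dterm_def)
  then have "supported UNIV n (\<lambda>v. - f v)" unfolding supported_def by (metis (no_types))
  then show "\<exists>n. supported UNIV n (\<lambda>v. - f v)" ..
qed simp

lemma dterm_scale: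
  assumes "dterm f"
  shows "dterm (\<lambda>v. n * f v)"
proof -
  have nat: "dterm (\<lambda>v. int k * f v)" for k
  proof (induction k)
    case (Suc k)
    show ?case using dterm_add[OF assms Suc] by (simp add: distrib_right)
  qed (simp add: dterm_zero)
  show ?thesis
    using nat[of "nat \<bar>n\<bar>"] dterm_uminus[OF nat[of "nat \<bar>n\<bar>"]] by (cases "0 \<le> n") simp_all
qed

lemma dterm_int: "dterm (\<lambda>v. n)"
  using dterm_scale[OF dterm_const[of 1, OF _ one], of n] by simp

lemma dterm_form:
  assumes "f \<in> forms S B"
  shows "dterm f"
proof -
  obtain k c where f: "f = (\<lambda>v. c + (\<Sum>i\<in>S. k i * v i))" using assms by (rule formsE)
  have "dterm (\<lambda>v. \<Sum>i\<in>S. k i * v i)"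
  proof (induction S rule: infinite_finite_induct)
    case (insert i S)
    then show ?case using dterm_add[OF dterm_scale[OF dterm_var[of i], of "k i"]] by simp
  qed (simp_all add: dterm_zero)
  then show ?thesis unfolding f by (rule dterm_add[OF dterm_int])
qed

lemma cong_mem:
  assumes "dterm f"
  shows "(\<lambda>v. [f v = c] (mod n)) \<in> C"
proof -
  obtain k where k: "supported UNIV k f" using assms by (auto simp: dterm_def)
  have "(\<lambda>v. \<exists>x. f v = c + n * x) \<in> C"
  proof (rule ex_int[of _ k])
    show "(\<lambda>v. f v = c + n * v k) \<in> C"
      by (intro eq_terms assms dterm_add dterm_int dterm_scale dterm_var)
    show "(f (v(k := x)) = c + n * y) = (f v = c + n * y)" for v x y
      using supported_upd[OF k, of k v x] by simp
  qed
  then show ?thesis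
    by (rule on_ext) (auto simp: cong_iff_dvd_diff dvd_def algebra_simps)
qed

lemma nonroot_mem:
  assumes "finite S" "dterm f"
  shows "(\<lambda>v. nonroot S B v (f v)) \<in> C"
  unfolding nonroot_def using finite_forms[OF assms(1)]
  by (intro finite_conj neg eq_terms dterm_add dterm_scale assms(2) dterm_int dterm_form) auto

end

section \<open>Periods of the fibres of a definable family\<close>

context prime_base
begin

lemma dvd_mult_prime_power:
  assumes "d dvd m * int p ^ k" "\<not> int p ^ Suc K dvd d"
  shows "d dvd m * int p ^ K"
proof -
  obtain a b where ab: "d = a * b" "a dvd m" "b dvd int p ^ k"
    using division_decomp[OF assms(1)] by blast
  then obtain j where j: "j \<le> k" "normalize b = normalize (int p ^ j)"
    using divides_primepow_weak[OF prime_int_p] by blast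
  have "b dvd int p ^ j" "int p ^ j dvd b" using j(2) associated_iff_dvd by blast+
  then have "\<not> int p ^ Suc K dvd int p ^ j" using assms(2) ab(1) by (meson dvd_mult dvd_trans)
  then have "j \<le> K" by (meson le_imp_power_dvd not_less_eq_eq)
  then have "b dvd int p ^ K" using \<open>b dvd int p ^ j\<close> by (meson dvd_trans le_imp_power_dvd)
  then show ?thesis using ab by (simp add: mult_dvd_mono)
qed

end

text \<open>Fibres are periodic only away from roots, so both \<open>x\<close> and
  \<open>x + g\<close> have to avoid them.\<close>

definition period :: "nat set \<Rightarrow> nat \<Rightarrow> nat \<Rightarrow> ((nat \<Rightarrow> int) \<Rightarrow> bool) \<Rightarrow> (nat \<Rightarrow> int) \<Rightarrow> int \<Rightarrow> bool" where
  "period S B i P b g \<longleftrightarrow>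
     (\<forall>x. nonroot S B b x \<longrightarrow> nonroot S B b (x + g) \<longrightarrow> P (b(i := x + g)) = P (b(i := x)))"

lemma period_depends:
  assumes "depends_on (insert i S) P" "\<And>l. l \<in> S \<Longrightarrow> v l = w l"
  shows "period S B i P v g = period S B i P w g"
proof -
  have "P (v(i := x)) = P (w(i := x))" for x
    using assms(2) by (intro depends_onD[OF assms(1)]) auto
  moreover have "nonroot S B v x = nonroot S B w x" for x
    by (rule nonroot_depends) (rule assms(2))
  ultimately show ?thesis by (simp add: period_def)
qed

lemma nonroot_upd: "i \<notin> S \<Longrightarrow> nonroot S B (v(i := x)) y = nonroot S B v y"
  by (rule nonroot_depends) auto

context group_class
begin

lemma period_mem:
  assumes P: "P \<in> C" "depends_on (insert i S) P" and S: "finite S" "i \<notin> S" and f: "dterm f"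
  shows "(\<lambda>v. period S B i P v (f v)) \<in> C"
proof -
  have "finite (insert i S)" using S by simp
  then obtain j where j: "j \<notin> insert i S" using ex_new_if_finite infinite_UNIV_nat by metis
  have "(\<lambda>v. period S B i P v (v j)) \<in> C"
    unfolding period_def
  proof (rule all_int[of _ i])
    have "(\<lambda>v. P (v(i := v i + v j))) \<in> C" "(\<lambda>v. P (v(i := v i))) \<in> C"
      by (intro subst_term P dterm_add dterm_var)+
    then show "(\<lambda>v. nonroot S B v (v i) \<longrightarrow> nonroot S B v (v i + v j) \<longrightarrow>
        P (v(i := v i + v j)) = P (v(i := v i))) \<in> C"
      by (intro imp iff nonroot_mem S dterm_add dterm_var)
  qed (use S j in \<open>simp add: nonroot_upd\<close>)
  from subst_term[OF this f, of j] show ?thesis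
  proof (rule on_ext)
    fix v
    have "period S B i P (v(j := f v)) g = period S B i P v g" for g
      using j by (intro period_depends[OF P(2)]) auto
    then show "period S B i P (v(j := f v)) ((v(j := f v)) j) = period S B i P v (f v)" by simp
  qed
qed

text \<open>If one modulus \<open>M\<close> serves all fibres, then away from the roots
  \<open>P\<close> is decided by the residue of \<open>v i\<close> and by the residues
  \<open>c\<close> that the fibre contains, recorded by \<open>Q c\<close>. At a root it is decided
  by the linear equation and by \<open>R\<close>. Both \<open>Q\<close> and \<open>R\<close> have
  lost the variable \<open>i\<close>, so the hypothesis on \<open>S\<close> applies to them.\<close>

lemma uniform_modulus_mem:
  assumes G: "group_class G"
    and P: "P \<in> C" "depends_on (insert i S) P" and S: "finite S" "i \<notin> S"
    and M: "0 < M" "\<And>b x x'. nonroot S B b x \<Longrightarrow> nonroot S B b x' \<Longrightarrow> [x = x'] (mod M) \<Longrightarrow>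
      P (b(i := x)) = P (b(i := x'))"
    and IH: "\<And>Q. Q \<in> C \<Longrightarrow> depends_on S Q \<Longrightarrow> Q \<in> G"
  shows "P \<in> G"
proof -
  interpret G: group_class G by fact
  define I where "I = {- int B..int B} - {0}"
  define Q where "Q c v \<longleftrightarrow> (\<exists>x. nonroot S B v x \<and> [x = c] (mod M) \<and> P (v(i := x)))" for c v
  define R where "R \<alpha> t v \<longleftrightarrow> (\<exists>x. \<alpha> * x + t v = 0 \<and> P (v(i := x)))" for \<alpha> t v
  have dep: "P (v(i := x)) = P (w(i := x))" if "\<forall>l\<in>S. v l = w l" for v w x
    using that by (intro depends_onD[OF P(2)]) auto
  have "(\<lambda>v. nonroot S B v (v i) \<and> [v i = c] (mod M) \<and> P v) \<in> C" for c
    by (intro conj nonroot_mem cong_mem dterm_var S P)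
  then have "Q c \<in> C" for c
    unfolding Q_def using S by (intro ex_int[of _ i]) (simp_all add: nonroot_upd)
  moreover have "depends_on S (Q c)" for c
    unfolding depends_on_def Q_def using dep nonroot_depends[of S] by meson
  ultimately have Q: "Q c \<in> G" for c by (rule IH)
  have "R \<alpha> t \<in> G" if t: "t \<in> forms S B" for \<alpha> t
  proof (rule IH)
    have "(\<lambda>v. \<alpha> * v i + t v = 0 \<and> P v) \<in> C"
      by (intro conj eq_terms dterm_add dterm_scale dterm_var dterm_int dterm_form[OF t] P)
    then show "R \<alpha> t \<in> C"
      unfolding R_def using S t by (intro ex_int[of _ i]) simp_all
    show "depends_on S (R \<alpha> t)"
      unfolding depends_on_def R_def using dep forms_depends[OF t] by (intro allI impI) metis
  qed
  then have "(\<lambda>v. (nonroot S B v (v i) \<and> (\<exists>c\<in>{0..<M}. [v i = c] (mod M) \<and> Q c v)) \<or>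
      (\<exists>\<alpha>\<in>I. \<exists>t\<in>forms S B. \<alpha> * v i + t v = 0 \<and> R \<alpha> t v)) \<in> G"
    using Q S finite_forms[OF S(1)] unfolding I_def
    by (intro G.disj G.conj G.finite_disj G.nonroot_mem G.cong_mem G.eq_terms G.dterm_add G.dterm_scale
        G.dterm_var G.dterm_int G.dterm_form) auto
  then show ?thesis
  proof (rule G.on_ext)
    fix v
    show "((nonroot S B v (v i) \<and> (\<exists>c\<in>{0..<M}. [v i = c] (mod M) \<and> Q c v)) \<or>
      (\<exists>\<alpha>\<in>I. \<exists>t\<in>forms S B. \<alpha> * v i + t v = 0 \<and> R \<alpha> t v)) = P v" (is "?A \<or> ?B \<longleftrightarrow> _")
    proof
      assume "?A \<or> ?B"
      then show "P v"
      proof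
        assume ?A
        then obtain c x where "nonroot S B v (v i)" "[v i = c] (mod M)" "nonroot S B v x" "[x = c] (mod M)"
          "P (v(i := x))" by (auto simp: Q_def)
        then show "P v" using M(2)[of v "v i" x] by (metis cong_sym cong_trans fun_upd_triv)
      next
        assume ?B
        then obtain \<alpha> t x where "\<alpha> \<noteq> 0" "\<alpha> * v i + t v = 0" "\<alpha> * x + t v = 0" "P (v(i := x))"
          by (auto simp: R_def I_def)
        moreover from this have "x = v i" by (metis add_right_cancel mult_left_cancel)
        ultimately show "P v" by simp
      qed
    next
      assume "P v"
      show "?A \<or> ?B"
      proof (cases "nonroot S B v (v i)")
        case True
        have "Q (v i mod M) v"
          unfolding Q_def using True \<open>P v\<close> by (intro exI[of _ "v i"]) simp
        then have ?A using True M(1) by (intro conjI bexI[of _ "v i mod M"]) simp_all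
        then show ?thesis ..
      next
        case False
        then obtain \<alpha> t where 1: "\<alpha> \<in> I" "t \<in> forms S B" "\<alpha> * v i + t v = 0"
          unfolding nonroot_def I_def by blast
        then have "R \<alpha> t v" unfolding R_def using \<open>P v\<close> by (intro exI[of _ "v i"]) simp
        then show ?thesis using 1 by blast
      qed
    qed
  qed
qed

end

section \<open>The dichotomy between bounded and unbounded periods\<close>

context prime_base
begin

lemma group_class_padic_class: "group_class padic_class"
  by (intro group_class.intro group_class_axioms.intro fo_class_padic_class padic_class_plus padic_class_one)

lemma period_modulus:
  assumes P: "\<And>a b. sim (insert i S) B m a b \<Longrightarrow> P a = P b" and S: "finite S" "i \<notin> S" and m: "0 < m"
  shows "\<exists>d>0. (\<exists>k. d dvd m * int p ^ k) \<and> (\<forall>g. period S B i P b g \<longleftrightarrow> d dvd g)"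
proof -
  obtain k where k: "\<forall>x x'. nonroot S B b x \<longrightarrow> nonroot S B b x' \<longrightarrow> [x = x'] (mod m * int p ^ k) \<longrightarrow>
    P (b(i := x)) = P (b(i := x'))"
    using eventually_periodic[where P = P and b = b, OF P S] by blast
  have "m * int p ^ k \<noteq> 0" using m p_gt_1 by simp
  from periods_modulus[OF finite_roots[OF S(1), of B b] this, of "\<lambda>x. P (b(i := x))"] k
  obtain d where "0 < d" "d dvd m * int p ^ k" "\<And>g. period S B i P b g \<longleftrightarrow> d dvd g"
    unfolding period_def mem_Collect_eq not_not by metis
  then show ?thesis by blast
qed

lemma unbounded_modulus_val_mem:
  assumes C: "group_class C" "C \<subseteq> padic_class"
    and P: "P \<in> C" "depends_on (insert i S) P" "\<And>a b. sim (insert i S) B m a b \<Longrightarrow> P a = P b"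
    and S: "finite S" "i \<notin> S" and m: "0 < m" "coprime m (int p)"
    and unbounded: "\<And>M. 0 < M \<Longrightarrow> \<exists>b. \<not> period S B i P b M"
  shows "(\<lambda>v. val (v 0) \<le> val (v 1)) \<in> C"
proof -
  interpret C: group_class C by fact
  interpret PC: group_class padic_class by (rule group_class_padic_class)
  have "\<forall>b. \<exists>d. 0 < d \<and> (\<exists>k. d dvd m * int p ^ k) \<and> (\<forall>g. period S B i P b g \<longleftrightarrow> d dvd g)"
    using period_modulus[where P = P, OF P(3) S m(1)] by blast
  from choice[OF this] obtain d where d: "\<And>b. 0 < d b" "\<And>b. \<exists>k. d b dvd m * int p ^ k"
      "\<And>b g. period S B i P b g \<longleftrightarrow> d b dvd g"
    by blast
  \<comment> \<open>If \<open>p ^ K\<close> divided no \<open>d b\<close>, then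
    \<open>m * p ^ K\<close> would be a period of every fibre.\<close>
  have large: "\<exists>b. int p ^ K dvd d b" for K
  proof (rule ccontr)
    assume "\<nexists>b. int p ^ K dvd d b"
    then have "\<not> int p ^ Suc K dvd d b" for b by (metis dvd_mult_right power_Suc)
    then have "d b dvd m * int p ^ K" for b using d(2)[of b] dvd_mult_prime_power by blast
    moreover have "0 < m * int p ^ K" using m(1) p_gt_1 by simp
    ultimately show False using unbounded[of "m * int p ^ K"] d(3) by blast
  qed
  have "finite (insert i S)" using S by simp
  then obtain n where n: "\<forall>l\<in>insert i S. l < n" using finite_nat_set_iff_bounded by blast
  \<comment> \<open>The offsets keep \<open>j\<close> and \<open>j'\<close> clear of the indices 0
    and 1, to which they are renamed at the end.\<close>
  define j where "j = n + 2"
  define j' where "j' = n + 3"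
  have j: "j \<notin> S" "j' \<notin> S" "j \<noteq> i" "j' \<noteq> i" "j \<noteq> j'" "j \<noteq> 0" "j \<noteq> 1" "j' \<noteq> 0" "j' \<noteq> 1"
    using n by (auto simp: j_def j'_def)
  have d_depends: "d v = d w" if "\<forall>l\<in>S. v l = w l" for v w
  proof -
    have "d v dvd g \<longleftrightarrow> d w dvd g" for g
      using period_depends[OF P(2), of v w B g] that d(3) by blast
    then show ?thesis using d(1)[of v] d(1)[of w] by (metis dvd_refl order_less_imp_le zdvd_antisym_nonneg)
  qed
  \<comment> \<open>\<open>W\<close> says that \<open>val (v j)\<close> occurs among the valuations
    of the \<open>d b\<close>. Quantifying over \<open>w\<close> means quantifying over the
    parameters in \<open>S\<close>, which leaves a unary predicate.\<close>
  define W where "W v \<longleftrightarrow> (\<exists>w. (\<forall>l. l \<notin> S \<longrightarrow> w l = v l) \<and> val (w j) = val (d w))" for v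
  have W_iff: "W v \<longleftrightarrow> (\<exists>b. val (v j) = val (d b))" for v
  proof
    assume "\<exists>b. val (v j) = val (d b)"
    then obtain b where b: "val (v j) = val (d b)" ..
    define w where "w l = (if l \<in> S then b l else v l)" for l
    have "d w = d b" by (rule d_depends) (simp add: w_def)
    then show "W v" unfolding W_def using j b by (intro exI[of _ w]) (simp add: w_def)
  qed (use j in \<open>auto simp: W_def\<close>)
  have W_mem: "W \<in> padic_class"
  proof -
    have val_d: "val (w j) = val (d w) \<longleftrightarrow> (\<exists>g. period S B i P w g \<and> val g \<le> val (w j)) \<and>
        (\<forall>g. period S B i P w g \<longrightarrow> val (w j) \<le> val g)" for w
    proof -
      have "val (d w) \<le> val g" if "d w dvd g" for g using that by (auto simp: val_le_iff intro: dvd_trans)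
      then show ?thesis unfolding d(3) by (metis antisym dvd_refl order_trans)
    qed
    have per: "(\<lambda>v. period S B i P v (v j')) \<in> padic_class"
      using C(2) C.period_mem[OF P(1,2) S C.dterm_var] by blast
    have per_upd: "period S B i P (v(j' := x)) y = period S B i P v y" for v x y
      using j by (intro period_depends[OF P(2)]) auto
    have "(\<lambda>w. \<exists>g. period S B i P w g \<and> val g \<le> val (w j)) \<in> padic_class"
    proof (rule PC.ex_int[of _ j'])
      show "(\<lambda>v. period S B i P v (v j') \<and> val (v j') \<le> val (v j)) \<in> padic_class"
        by (intro PC.conj per padic_class_val_le)
      show "(period S B i P (v(j' := x)) y \<and> val y \<le> val ((v(j' := x)) j)) =
          (period S B i P v y \<and> val y \<le> val (v j))" for v x y
        using j by (simp add: per_upd)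
    qed
    moreover have "(\<lambda>w. \<forall>g. period S B i P w g \<longrightarrow> val (w j) \<le> val g) \<in> padic_class"
    proof (rule PC.all_int[of _ j'])
      show "(\<lambda>v. period S B i P v (v j') \<longrightarrow> val (v j) \<le> val (v j')) \<in> padic_class"
        by (intro PC.imp per padic_class_val_le)
      show "(period S B i P (v(j' := x)) y \<longrightarrow> val ((v(j' := x)) j) \<le> val y) =
          (period S B i P v y \<longrightarrow> val (v j) \<le> val y)" for v x y
        using j by (simp add: per_upd)
    qed
    ultimately have "(\<lambda>w. val (w j) = val (d w)) \<in> padic_class"
      unfolding val_d by (rule PC.conj)
    from PC.neg[OF PC.all_vars_int[OF S(1) PC.neg[OF this]]] show ?thesis
      by (rule PC.on_ext) (auto simp: W_def)
  qed
  have "depends_on {j} W" by (simp add: depends_on_def W_iff)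
  then obtain B2 m2 where m2: "0 < m2" "coprime m2 (int p)"
    and W: "\<And>a b. sim {j} B2 m2 a b \<Longrightarrow> W a = W b"
    using padic_class_trim[OF W_mem, of "{j}"] by blast
  define origin where "origin = (\<lambda>l :: nat. 0 :: int)"
  obtain k2 where k2: "\<And>x x'. nonroot {} B2 origin x \<Longrightarrow> nonroot {} B2 origin x' \<Longrightarrow> [x = x'] (mod m2 * int p ^ k2) \<Longrightarrow>
      W (origin(j := x)) = W (origin(j := x'))"
    using eventually_periodic[where S = "{}" and i = j and P = W, OF W] by blast
  \<comment> \<open>Every valuation from \<open>k2\<close> on is met in the residue class of 0
    modulo \<open>m2 * p ^ k2\<close>, off the roots. \<open>W\<close> is constant there, so one
    such valuation that is attained by some \<open>d b\<close> yields all of them.\<close>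
  have representative: "\<exists>x. nonroot {} B2 origin x \<and> val x = enat k \<and> m2 * int p ^ k2 dvd x" if "k2 \<le> k" for k
  proof -
    have "int p ^ k * m2 * int p \<noteq> 0" using m2(1) p_gt_1 by simp
    \<comment> \<open>Steps of \<open>p ^ k * m2 * p\<close> change only the factor
      \<open>1 + p * l\<close>, which is prime to p, so the valuation stays
      \<open>k\<close>.\<close>
    from ex_progression_notin[OF finite_roots[of "{}" B2 origin] this, of "int p ^ k * m2"] obtain l
      where l: "nonroot {} B2 origin (int p ^ k * m2 + int p ^ k * m2 * int p * l)" by auto
    have "\<not> int p dvd m2 * (1 + int p * l)"
    proof
      assume "int p dvd m2 * (1 + int p * l)"
      moreover have "\<not> int p dvd m2"
        using m2(2) p_gt_1 coprime_common_divisor[of m2 "int p" "int p"] by auto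
      ultimately have "int p dvd 1 + int p * l" using prime_int_p prime_dvd_mult_iff by blast
      then have "int p dvd 1" by (simp add: dvd_add_left_iff)
      then show False using p_gt_1 by simp
    qed
    then have "val (m2 * (1 + int p * l) * int p ^ k) = enat k" by (simp add: val_mult_coprime)
    moreover have "m2 * int p ^ k2 dvd m2 * int p ^ k * (1 + int p * l)"
      using that by (intro dvd_mult2 mult_dvd_mono le_imp_power_dvd) auto
    ultimately show ?thesis
      using l by (intro exI[of _ "int p ^ k * m2 + int p ^ k * m2 * int p * l"]) (simp add: algebra_simps)
  qed
  have all_values: "\<exists>b. val (d b) = enat k" if "k2 \<le> k" for k
  proof -
    obtain b0 where b0: "int p ^ k2 dvd d b0" using large by blast
    obtain k1 where k1: "val (d b0) = enat k1" using d(1)[of b0] by (cases "val (d b0)") auto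
    have "k2 \<le> k1" using b0 k1 by (simp flip: enat_le_val_iff)
    then obtain x where x: "nonroot {} B2 origin x" "val x = enat k1" "m2 * int p ^ k2 dvd x"
      using representative by blast
    obtain x' where x': "nonroot {} B2 origin x'" "val x' = enat k" "m2 * int p ^ k2 dvd x'"
      using representative \<open>k2 \<le> k\<close> by blast
    have "[x = x'] (mod m2 * int p ^ k2)" using x(3) x'(3) by (simp add: cong_iff_dvd_diff)
    then have "W (origin(j := x)) = W (origin(j := x'))" by (rule k2[OF x(1) x'(1)])
    then show ?thesis using x(2) x'(2) k1 by (auto simp: W_iff) metis
  qed
  \<comment> \<open>If \<open>val (d b) = k\<close>, then \<open>d b\<close> divides
    \<open>m * p ^ k\<close>, so the factor \<open>m\<close> takes care of everything prime to p.
    The factor \<open>p ^ k2\<close> lifts valuations to where all values occur.\<close>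
  define c where "c = int p ^ k2 * m"
  have "\<not> int p dvd m" using m(2) p_gt_1 coprime_common_divisor[of m "int p" "int p"] by auto
  then have val_c: "val (c * z) = enat k2 + val z" for z by (simp add: c_def val_mult val_coprime)
  have dvd_of_val: "d b dvd m * int p ^ k" if "val (d b) = enat k" for b k
    using d(2)[of b] dvd_mult_prime_power val_le_enat_iff[of "d b" k] that by auto
  have characterization: "val x \<le> val y \<longleftrightarrow> (\<forall>b. d b dvd c * x \<longrightarrow> d b dvd c * y)" for x y
  proof
    assume le: "val x \<le> val y"
    show "\<forall>b. d b dvd c * x \<longrightarrow> d b dvd c * y"
    proof (intro allI impI)
      fix b assume b: "d b dvd c * x"
      obtain k where k: "val (d b) = enat k" using d(1)[of b] by (cases "val (d b)") auto
      then have "int p ^ k dvd c * x" using b enat_le_val_iff[of k "d b"] by (auto intro: dvd_trans)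
      then have "enat k \<le> enat k2 + val x" by (metis enat_le_val_iff val_c)
      also have "\<dots> \<le> enat k2 + val y" using le by (rule add_left_mono)
      finally have "int p ^ k dvd int p ^ k2 * y" by (simp flip: enat_le_val_iff add: val_mult)
      then have "m * int p ^ k dvd m * (int p ^ k2 * y)" by (intro mult_dvd_mono) auto
      also have "m * (int p ^ k2 * y) = c * y" by (simp add: c_def)
      finally show "d b dvd c * y" using dvd_of_val[OF k] dvd_trans by blast
    qed
  next
    assume all: "\<forall>b. d b dvd c * x \<longrightarrow> d b dvd c * y"
    show "val x \<le> val y"
    proof (rule ccontr)
      assume "\<not> val x \<le> val y"
      then obtain h where h: "val y = enat h" "enat (Suc h) \<le> val x"
        by (cases "val y") (auto simp: not_le Suc_ile_eq)
      \<comment> \<open>The valuation of \<open>d b\<close> is one more than that of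
        \<open>c * y\<close>, so \<open>d b\<close> divides \<open>c * x\<close> but not
        \<open>c * y\<close>.\<close>
      obtain b where b: "val (d b) = enat (k2 + Suc h)" using all_values[of "k2 + Suc h"] by auto
      have "m * int p ^ (k2 + Suc h) = c * int p ^ Suc h" by (simp add: c_def power_add)
      also have "\<dots> dvd c * x" using h(2) enat_le_val_iff[of "Suc h" x] by (intro mult_dvd_mono) auto
      finally have "d b dvd c * y" using dvd_of_val[OF b] all dvd_trans by blast
      moreover have "int p ^ (k2 + Suc h) dvd d b" using b enat_le_val_iff[of "k2 + Suc h" "d b"] by simp
      ultimately have "int p ^ (k2 + Suc h) dvd c * y" by (rule dvd_trans[rotated])
      then have "enat (k2 + Suc h) \<le> val (c * y)" by (simp only: enat_le_val_iff)
      then show False using h(1) by (simp add: val_c)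
    qed
  qed
  \<comment> \<open>This is \<open>characterization\<close> with divisibility by \<open>d b\<close>
    read as being a period. Since \<open>j\<close> and \<open>j'\<close> are not in
    \<open>S\<close>, they keep their values while the parameters vary.\<close>
  have "(\<lambda>v. \<forall>w. (\<forall>l. l \<notin> S \<longrightarrow> w l = v l) \<longrightarrow>
      (period S B i P w (c * w j) \<longrightarrow> period S B i P w (c * w j'))) \<in> C"
    by (intro C.all_vars_int C.imp C.period_mem P S C.dterm_scale C.dterm_var)
  then have "(\<lambda>v. val (v j) \<le> val (v j')) \<in> C"
  proof (rule C.on_ext)
    fix v
    show "(\<forall>w. (\<forall>l. l \<notin> S \<longrightarrow> w l = v l) \<longrightarrow> (period S B i P w (c * w j) \<longrightarrow> period S B i P w (c * w j'))) =
        (val (v j) \<le> val (v j'))"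
      unfolding characterization d(3)
    proof (intro iffI allI impI)
      fix b assume *: "\<forall>w. (\<forall>l. l \<notin> S \<longrightarrow> w l = v l) \<longrightarrow> d w dvd c * w j \<longrightarrow> d w dvd c * w j'" and b: "d b dvd c * v j"
      define w where "w l = (if l \<in> S then b l else v l)" for l
      have "d w = d b" by (rule d_depends) (simp add: w_def)
      then show "d b dvd c * v j'" using *[rule_format, of w] b j by (simp add: w_def)
    next
      fix w assume "\<forall>b. d b dvd c * v j \<longrightarrow> d b dvd c * v j'" "\<forall>l. l \<notin> S \<longrightarrow> w l = v l" "d w dvd c * w j"
      then show "d w dvd c * w j'" using j by simp
    qed
  qed
  from C.subst_var[OF C.subst_var[OF this, of j' 1], of j 0] show ?thesis
    using j by simp
qed

text \<open>Induction on the number of variables: if \<open>|_p\<close> is not in \<open>C\<close>,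
  each predicate of \<open>C\<close> has a period common to all its fibres, so it reduces to
  predicates in fewer variables and conditions available in every \<open>G\<close>.\<close>

theorem val_mem_or_subset:
  assumes C: "group_class C" "C \<subseteq> padic_class" and G: "group_class G"
  shows "(\<lambda>v. val (v 0) \<le> val (v 1)) \<in> C \<or> C \<subseteq> G"
proof (cases "(\<lambda>v. val (v 0) \<le> val (v 1)) \<in> C")
  case False
  interpret C: group_class C by fact
  interpret G: group_class G by fact
  have "P \<in> G" if "finite S" "P \<in> C" "depends_on S P" for S P
    using that
  proof (induction S arbitrary: P rule: finite_induct)
    case empty
    have "(\<lambda>v. P (\<lambda>_. 0)) \<in> G" by (rule G.const)
    then show ?case by (rule G.on_ext) (rule depends_onD[OF empty.prems(2)], simp)
  next
    case (insert i S)
    have fin: "finite (insert i S)" using insert.hyps by simp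
    have "P \<in> padic_class" using insert.prems C(2) by blast
    from padic_class_trim[OF this fin insert.prems(2)] obtain B m where m: "0 < m" "coprime m (int p)"
      and P: "\<And>a b. sim (insert i S) B m a b \<Longrightarrow> P a = P b" by blast
    have "\<not> (\<forall>M. 0 < M \<longrightarrow> (\<exists>b. \<not> period S B i P b M))"
      using unbounded_modulus_val_mem[where P = P, OF C insert.prems P insert.hyps m] False by blast
    then obtain M where M: "0 < M" "\<And>b. period S B i P b M" by blast
    show ?case
    proof (rule C.uniform_modulus_mem[OF G insert.prems insert.hyps M(1) _ insert.IH])
      fix b x x' assume x: "nonroot S B b x" "nonroot S B b x'" "[x = x'] (mod M)"
      \<comment> \<open>The common period \<open>M\<close> is a multiple of the minimal one, so any
        difference divisible by \<open>M\<close> is a period as well.\<close>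
      have "period S B i P b (x' - x)"
        using period_modulus[where P = P and b = b, OF P insert.hyps m(1)] M(2)[of b] cong_sym[OF x(3)]
        by (metis cong_iff_dvd_diff dvd_trans)
      then show "P (b(i := x)) = P (b(i := x'))" using x(1,2) unfolding period_def by (metis add_diff_cancel_left' add.commute diff_add_cancel)
    qed
  qed
  moreover have "\<exists>S. finite S \<and> depends_on S P" if P: "P \<in> C" for P
  proof -
    obtain n where "supported UNIV n P" using C.supp[OF P] by blast
    then have "depends_on {..<n} P" by (auto simp: supported_def depends_on_def)
    then show ?thesis by blast
  qed
  ultimately show ?thesis by blast
qed simp

end

section \<open>Transfer to elementary extensions\<close>

abbreviation iff_fm :: "('f, 'r) fm \<Rightarrow> ('f, 'r) fm \<Rightarrow> ('f, 'r) fm" where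
  "iff_fm \<phi> \<psi> \<equiv> Conj (Neg (Conj \<phi> (Neg \<psi>))) (Neg (Conj \<psi> (Neg \<phi>)))"

text \<open>Elementarity concerns assignments into the smaller structure only. Once \<open>n\<close>
  exceeds all free variables, this is a universal closure, and its truth speaks about all
  assignments into either structure.\<close>

primrec all_below :: "nat \<Rightarrow> ('f, 'r) fm \<Rightarrow> ('f, 'r) fm" where
  "all_below 0 \<phi> = \<phi>"
| "all_below (Suc n) \<phi> = Neg (Exi n (Neg (all_below n \<phi>)))"

lemma is_fm_all_below [simp]: "is_fm L (all_below n \<phi>) = is_fm L \<phi>"
  by (induction n) auto

lemma sat_all_below:
  assumes "range v \<subseteq> universe M"
  shows "sat M v (all_below n \<phi>) \<longleftrightarrow>
    (\<forall>w. range w \<subseteq> universe M \<longrightarrow> (\<forall>i\<ge>n. w i = v i) \<longrightarrow> sat M w \<phi>)"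
  using assms
proof (induction n arbitrary: v)
  case 0
  have "w = v" if "\<forall>i\<ge>0. w i = v i" for w using that by (intro ext) simp
  then show ?case using 0 by auto
next
  case (Suc n)
  have "sat M v (all_below (Suc n) \<phi>) \<longleftrightarrow> (\<forall>a\<in>universe M. \<forall>w. range w \<subseteq> universe M \<longrightarrow>
      (\<forall>i\<ge>n. w i = (v(n := a)) i) \<longrightarrow> sat M w \<phi>)"
  proof -
    have "sat M v (all_below (Suc n) \<phi>) \<longleftrightarrow> (\<forall>a\<in>universe M. sat M (v(n := a)) (all_below n \<phi>))"
      by simp
    also have "\<dots> \<longleftrightarrow> (\<forall>a\<in>universe M. \<forall>w. range w \<subseteq> universe M \<longrightarrow>
      (\<forall>i\<ge>n. w i = (v(n := a)) i) \<longrightarrow> sat M w \<phi>)"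
      by (intro ball_cong refl Suc.IH range_updI Suc.prems)
    finally show ?thesis .
  qed
  also have "\<dots> \<longleftrightarrow> (\<forall>w. range w \<subseteq> universe M \<longrightarrow> (\<forall>i\<ge>Suc n. w i = v i) \<longrightarrow> sat M w \<phi>)"
  proof (intro iffI allI ballI impI)
    fix w assume *: "\<forall>a\<in>universe M. \<forall>w. range w \<subseteq> universe M \<longrightarrow>
      (\<forall>i\<ge>n. w i = (v(n := a)) i) \<longrightarrow> sat M w \<phi>"
      and w: "range w \<subseteq> universe M" "\<forall>i\<ge>Suc n. w i = v i"
    have "w n \<in> universe M" using w(1) by auto
    moreover have "\<forall>i\<ge>n. w i = (v(n := w n)) i" using w(2) by (simp add: Suc_le_eq)
    ultimately show "sat M w \<phi>" using * w(1) by blast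
  qed auto
  finally show ?case .
qed

definition valid :: "('f, 'r, 'a) struct \<Rightarrow> ('f, 'r) fm \<Rightarrow> bool" where
  "valid M \<phi> \<longleftrightarrow> (\<forall>v. range v \<subseteq> universe M \<longrightarrow> sat M v \<phi>)"

lemma valid_iff_fm: "valid M (iff_fm \<phi> \<psi>) \<longleftrightarrow> (\<forall>v. range v \<subseteq> universe M \<longrightarrow> sat M v \<phi> = sat M v \<psi>)"
  by (auto simp: valid_def)

lemma valid_iff_sat_all_below:
  assumes "range v \<subseteq> universe M" "\<And>i. i \<in> free_vars \<phi> \<Longrightarrow> i < n"
  shows "valid M \<phi> \<longleftrightarrow> sat M v (all_below n \<phi>)"
proof -
  have "sat M w \<phi>" if w: "range w \<subseteq> universe M"
    and all: "\<forall>w. range w \<subseteq> universe M \<longrightarrow> (\<forall>i\<ge>n. w i = v i) \<longrightarrow> sat M w \<phi>" for w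
  proof -
    define u where "u i = (if i < n then w i else v i)" for i
    have "range u \<subseteq> universe M" using w assms(1) by (auto simp: u_def)
    then have "sat M u \<phi>" using all by (simp add: u_def)
    then show ?thesis using assms(2) sat_cong[of \<phi> u w M] by (simp add: u_def)
  qed
  then show ?thesis unfolding sat_all_below[OF assms(1)] valid_def by blast
qed

lemma elementary_extension_valid:
  assumes "elementary_extension L M e N" "is_fm L \<phi>"
  shows "valid M \<phi> \<longleftrightarrow> valid N \<phi>"
proof -
  obtain u where u: "u \<in> universe M"
    using assms(1) by (auto simp: elementary_extension_def is_struct_def)
  obtain n where n: "\<forall>i\<in>free_vars \<phi>. i < n"
    using finite_free_vars[of \<phi>] finite_nat_set_iff_bounded by blast
  have 1: "range (\<lambda>_ :: nat. u) \<subseteq> universe M" using u by auto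
  then have 2: "range (e \<circ> (\<lambda>_ :: nat. u)) \<subseteq> universe N"
    using assms(1) by (auto simp: elementary_extension_def)
  have "sat M (\<lambda>_. u) (all_below n \<phi>) \<longleftrightarrow> sat N (e \<circ> (\<lambda>_. u)) (all_below n \<phi>)"
    using assms 1 unfolding elementary_extension_def by simp
  then show ?thesis
    using valid_iff_sat_all_below[OF 1, of \<phi> n] valid_iff_sat_all_below[OF 2, of \<phi> n] n by simp
qed

section \<open>Reducts as inclusions between classes of predicates\<close>

lemma map_upt_cong:
  "\<forall>i<n. v i = w i \<Longrightarrow> map v [0..<n] = map w [0..<n]"
  by simp

text \<open>Over a nonempty universe, quantifying a variable on which the truth value does not
  depend changes nothing, but removes it from the free variables, which
  \<open>definable_over\<close> restricts syntactically.\<close>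

lemma formula_predicates_trim:
  assumes "is_fm L \<phi>" "\<And>v. range v \<subseteq> universe M \<Longrightarrow> sat M v \<phi> = P v"
    and "supported (universe M) n P" "universe M \<noteq> {}"
  shows "\<exists>\<psi>. is_fm L \<psi> \<and> free_vars \<psi> \<subseteq> {..<n} \<and> (\<forall>v. range v \<subseteq> universe M \<longrightarrow> sat M v \<psi> = P v)"
proof -
  have ex: "is_fm L (foldr Exi is \<phi>) \<and> free_vars (foldr Exi is \<phi>) = free_vars \<phi> - set is \<and>
      (\<forall>v. range v \<subseteq> universe M \<longrightarrow> sat M v (foldr Exi is \<phi>) = P v)"
    if "set is \<subseteq> {n..}" for "is"
    using that
  proof (induction "is")
    case (Cons i "is")
    have "sat M v (foldr Exi (i # is) \<phi>) = P v" if v: "range v \<subseteq> universe M" for v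
    proof -
      have "sat M (v(i := a)) (foldr Exi is \<phi>) = P v" if "a \<in> universe M" for a
        using Cons range_updI[OF v that] supported_upd[OF assms(3) _ v that, of i] by simp
      then show ?thesis using assms(4) by auto
    qed
    then show ?case using Cons by auto
  qed (use assms in simp)
  obtain k where "\<forall>i\<in>free_vars \<phi>. i < k"
    using finite_free_vars[of \<phi>] finite_nat_set_iff_bounded by blast
  then have "free_vars \<phi> - set [n..<k] \<subseteq> {..<n}" by auto
  moreover have "set [n..<k] \<subseteq> {n..}" by auto
  ultimately show ?thesis using ex[of "[n..<k]"] by (intro exI[of _ "foldr Exi [n..<k] \<phi>"]) metis
qed

lemma definable_over_empty_iff:
  assumes "universe M \<noteq> {}" "D \<subseteq> tuples (universe M) n"
  shows "definable_over L M {} n D \<longleftrightarrow> (\<lambda>v. map v [0..<n] \<in> D) \<in> formula_predicates L M"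
proof
  assume "definable_over L M {} n D"
  then obtain \<phi> where \<phi>: "is_fm L \<phi>" "free_vars \<phi> \<subseteq> {..<n}"
      "D = {xs \<in> tuples (universe M) n. sat M (\<lambda>i. xs ! i) \<phi>}"
    by (auto simp: definable_over_def)
  have "map v [0..<n] \<in> D \<longleftrightarrow> sat M v \<phi>" if "range v \<subseteq> universe M" for v
  proof -
    have "map v [0..<n] \<in> tuples (universe M) n" using that by (auto simp: tuples_def)
    moreover have "sat M (\<lambda>i. map v [0..<n] ! i) \<phi> = sat M v \<phi>"
      using \<phi>(2) by (intro sat_cong) auto
    ultimately show ?thesis by (simp add: \<phi>(3))
  qed
  then show "(\<lambda>v. map v [0..<n] \<in> D) \<in> formula_predicates L M"
    using \<phi>(1) unfolding formula_predicates_def by blast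
next
  assume "(\<lambda>v. map v [0..<n] \<in> D) \<in> formula_predicates L M"
  then obtain \<phi> where "is_fm L \<phi>" "\<And>v. range v \<subseteq> universe M \<Longrightarrow> sat M v \<phi> = (map v [0..<n] \<in> D)"
    unfolding formula_predicates_def by blast
  moreover have "supported (universe M) n (\<lambda>v. map v [0..<n] \<in> D)"
    unfolding supported_def using map_upt_cong by metis
  ultimately obtain \<psi> where \<psi>: "is_fm L \<psi>" "free_vars \<psi> \<subseteq> {..<n}"
    "\<And>v. range v \<subseteq> universe M \<Longrightarrow> sat M v \<psi> = (map v [0..<n] \<in> D)"
    using formula_predicates_trim[of L \<phi> M "\<lambda>v. map v [0..<n] \<in> D" n] assms(1) by blast
  obtain u where u: "u \<in> universe M" using assms(1) by blast
  have "xs \<in> D \<longleftrightarrow> sat M (\<lambda>i. xs ! i) \<psi>" if xs: "xs \<in> tuples (universe M) n" for xs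
  proof -
    \<comment> \<open>\<open>xs ! i\<close> is unspecified from \<open>n\<close> on; the default
      \<open>u\<close> keeps the assignment inside the universe.\<close>
    define v where "v i = (if i < n then xs ! i else u)" for i
    have "range v \<subseteq> universe M" using xs u by (auto simp: v_def tuples_def)
    moreover have "map v [0..<n] = xs" using xs by (auto simp: v_def tuples_def intro: nth_equalityI)
    ultimately have "xs \<in> D \<longleftrightarrow> sat M v \<psi>" using \<psi>(3) by simp
    also have "\<dots> \<longleftrightarrow> sat M (\<lambda>i. xs ! i) \<psi>"
      using \<psi>(2) by (intro sat_cong) (auto simp: v_def)
    finally show ?thesis .
  qed
  then have "D = {xs \<in> tuples (universe M) n. sat M (\<lambda>i. (xs @ []) ! i) \<psi>}"
    using assms(2) by auto
  then show "definable_over L M {} n D"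
    unfolding definable_over_def using \<psi>(1,2) by (intro exI[of _ \<psi>] exI[of _ "[]"]) simp
qed

lemma is_reduct_empty_iff:
  "is_reduct {} L\<^sub>1 M\<^sub>1 L\<^sub>2 M\<^sub>2 \<longleftrightarrow> is_struct L\<^sub>1 M\<^sub>1 \<and> is_struct L\<^sub>2 M\<^sub>2 \<and> universe M\<^sub>1 = universe M\<^sub>2 \<and>
     formula_predicates L\<^sub>1 M\<^sub>1 \<subseteq> formula_predicates L\<^sub>2 M\<^sub>2"
proof (cases "is_struct L\<^sub>1 M\<^sub>1 \<and> is_struct L\<^sub>2 M\<^sub>2 \<and> universe M\<^sub>1 = universe M\<^sub>2")
  case True
  then have ne: "universe M\<^sub>1 \<noteq> {}" "universe M\<^sub>2 \<noteq> {}" and eq: "universe M\<^sub>2 = universe M\<^sub>1"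
    by (auto simp: is_struct_def)
  have "formula_predicates L\<^sub>1 M\<^sub>1 \<subseteq> formula_predicates L\<^sub>2 M\<^sub>2"
    if red: "\<forall>n\<ge>1. \<forall>D\<subseteq>tuples (universe M\<^sub>1) n. definable_over L\<^sub>1 M\<^sub>1 {} n D \<longrightarrow> definable_over L\<^sub>2 M\<^sub>2 {} n D"
  proof
    fix P assume P: "P \<in> formula_predicates L\<^sub>1 M\<^sub>1"
    interpret FP1: fo_class "universe M\<^sub>1" "formula_predicates L\<^sub>1 M\<^sub>1" by (rule fo_class_formula_predicates)
    interpret FP2: fo_class "universe M\<^sub>2" "formula_predicates L\<^sub>2 M\<^sub>2" by (rule fo_class_formula_predicates)
    obtain n0 where "supported (universe M\<^sub>1) n0 P" using FP1.supp[OF P] by blast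
    \<comment> \<open>Reducts are defined by tuples of length \<open>n \<ge> 1\<close>, so the
      support is enlarged by one.\<close>
    then have supp: "supported (universe M\<^sub>1) (Suc n0) P" by (rule supported_mono) simp
    define n where "n = Suc n0"
    define D where "D = (\<lambda>v. map v [0..<n]) ` {v. range v \<subseteq> universe M\<^sub>1 \<and> P v}"
    have D: "map v [0..<n] \<in> D \<longleftrightarrow> P v" if v: "range v \<subseteq> universe M\<^sub>1" for v
    proof
      assume "map v [0..<n] \<in> D"
      then obtain w where w: "map v [0..<n] = map w [0..<n]" "range w \<subseteq> universe M\<^sub>1" "P w"
        unfolding D_def by blast
      then have "\<forall>i<Suc n0. v i = w i" by (auto simp: n_def less_Suc_eq)
      then show "P v" using supp v w(2,3) unfolding supported_def by blast
    qed (use v in \<open>auto simp: D_def\<close>)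
    have D_tuples: "D \<subseteq> tuples (universe M\<^sub>1) n" unfolding D_def tuples_def by fastforce
    have "(\<lambda>v. map v [0..<n] \<in> D) \<in> formula_predicates L\<^sub>1 M\<^sub>1"
      by (rule FP1.on_ext[OF P]) (simp add: D)
    then have "definable_over L\<^sub>1 M\<^sub>1 {} n D"
      using definable_over_empty_iff[OF ne(1) D_tuples] by blast
    then have "definable_over L\<^sub>2 M\<^sub>2 {} n D" using red D_tuples by (simp add: n_def)
    then have "(\<lambda>v. map v [0..<n] \<in> D) \<in> formula_predicates L\<^sub>2 M\<^sub>2"
      using definable_over_empty_iff[OF ne(2), of D n] D_tuples eq by simp
    then show "P \<in> formula_predicates L\<^sub>2 M\<^sub>2" by (rule FP2.on_ext) (simp add: D eq)
  qed
  moreover have "definable_over L\<^sub>2 M\<^sub>2 {} n D"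
    if "formula_predicates L\<^sub>1 M\<^sub>1 \<subseteq> formula_predicates L\<^sub>2 M\<^sub>2" "D \<subseteq> tuples (universe M\<^sub>1) n"
      "definable_over L\<^sub>1 M\<^sub>1 {} n D" for n D
    using that definable_over_empty_iff[OF ne(1), of D n] definable_over_empty_iff[OF ne(2), of D n] eq by auto
  ultimately show ?thesis using True unfolding is_reduct_def by blast
qed (auto simp: is_reduct_def)

text \<open>The fibre over \<open>p ^ n\<close> is \<open>p ^ n \<int>\<close>, which has no period \<open>m * q ^ k\<close> once \<open>p ^ n > m\<close>.\<close>

lemma val_le_not_other_prime:
  assumes "prime p" "prime q" "p \<noteq> q"
  shows "(\<lambda>v. padic_val p (v 0) \<le> padic_val p (v 1)) \<notin> prime_base.padic_class q"
proof
  interpret p: prime_base p by unfold_locales fact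
  interpret q: prime_base q by unfold_locales fact
  assume mem: "(\<lambda>v. p.val (v 0) \<le> p.val (v 1)) \<in> q.padic_class"
  have "depends_on {1, 0} (\<lambda>v. p.val (v 0) \<le> p.val (v 1))" by (auto simp: depends_on_def)
  from q.padic_class_trim[OF mem _ this] obtain B m where m: "0 < m"
    and inv: "\<And>a b. q.sim {1, 0} B m a b \<Longrightarrow> (p.val (a 0) \<le> p.val (a 1)) = (p.val (b 0) \<le> p.val (b 1))"
    by auto
  \<comment> \<open>For this parameter the fibre consists of the multiples of
    \<open>p ^ nat m\<close>, and \<open>nat m < p ^ nat m\<close>.\<close>
  define b where "b = (\<lambda>_ :: nat. int p ^ nat m)"
  obtain k where k: "\<And>x x'. nonroot {0} B b x \<Longrightarrow> nonroot {0} B b x' \<Longrightarrow> [x = x'] (mod m * int q ^ k) \<Longrightarrow>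
      (p.val (b 0) \<le> p.val x) = (p.val (b 0) \<le> p.val x')"
    using q.eventually_periodic[where P = "\<lambda>v. p.val (v 0) \<le> p.val (v 1)" and b = b and S = "{0}" and i = 1
      and B = B and m = m, OF inv]
    by auto
  have fin: "finite {x. \<not> nonroot {0} B b x}" by (rule finite_roots) simp
  have "int p ^ nat m \<noteq> 0" using p.p_gt_1 by simp
  from ex_progression_notin[OF fin this, of 0] obtain l where l: "nonroot {0} B b (int p ^ nat m * l)"
    by auto
  define n where "n = m * int q ^ k"
  have "n * int p \<noteq> 0" using m p.p_gt_1 q.p_gt_1 by (simp add: n_def)
  \<comment> \<open>Steps of \<open>n * p\<close> keep the distance between the two points of the
    form \<open>n * (1 + p * l')\<close>, which has the same p-adic valuation as
    \<open>n\<close>.\<close>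
  from ex_progression_notin[OF fin this, of "int p ^ nat m * l + n"] obtain l'
    where l': "nonroot {0} B b (int p ^ nat m * l + n + n * int p * l')" by auto
  have "[int p ^ nat m * l = int p ^ nat m * l + n + n * int p * l'] (mod n)"
    by (simp add: cong_iff_dvd_diff)
  then have "int p ^ nat m dvd int p ^ nat m * l + n + n * int p * l'"
    using k[OF l l'] by (simp add: n_def b_def flip: p.enat_le_val_iff) 
       (simp add: p.enat_le_val_iff)
  then have "int p ^ nat m dvd n + n * int p * l'"
    by (simp add: add.assoc dvd_add_right_iff)
  then have "enat (nat m) \<le> p.val (int q ^ k * (1 + int p * l') * m)"
    by (simp add: p.enat_le_val_iff n_def algebra_simps)
  moreover have "\<not> int p dvd int q ^ k * (1 + int p * l')"
  proof
    assume "int p dvd int q ^ k * (1 + int p * l')"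
    then have "int p dvd int q ^ k \<or> int p dvd 1 + int p * l'"
      using p.prime_int_p prime_dvd_mult_iff by blast
    moreover have "\<not> int p dvd int q ^ k"
      using assms p.prime_int_p q.prime_int_p by (metis int_dvd_int_iff prime_dvd_power primes_dvd_imp_eq)
    moreover have "\<not> int p dvd 1 + int p * l'" using p.p_gt_1 by (simp add: dvd_add_left_iff)
    ultimately show False by blast
  qed
  ultimately have "int p ^ nat m dvd m" by (simp add: p.val_mult_coprime p.enat_le_val_iff)
  then have "int p ^ nat m \<le> int (nat m)" using m zdvd_imp_le by simp
  then have "int (p ^ nat m) \<le> int (nat m)" by simp
  then have "p ^ nat m \<le> nat m" by (simp only: of_nat_le_iff)
  moreover have "nat m < p ^ nat m" using p.p_gt_1 by (simp add: power_gt_expt)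
  ultimately show False by simp
qed

section \<open>The group language inside the p-adic language\<close>

lemma is_fm_group_imp_padic:
  "is_fm group_language \<phi> \<Longrightarrow> is_fm padic_language \<phi>"
proof -
  have tm: "is_tm group_language t \<Longrightarrow> is_tm padic_language t" for t
  proof (induction t)
    case (Fun f ts)
    then show ?case by (auto simp: group_language_def list_all_iff)
  qed simp
  show "is_fm group_language \<phi> \<Longrightarrow> is_fm padic_language \<phi>"
    by (induction \<phi>) (auto simp: tm, auto simp: group_language_def)
qed

lemma formula_predicates_group_subset:
  "formula_predicates group_language N \<subseteq> formula_predicates padic_language N"
  unfolding formula_predicates_def using is_fm_group_imp_padic by blast

lemma is_struct_group_iff: "is_struct group_language N \<longleftrightarrow> is_struct padic_language N"
  by (simp add: is_struct_def group_language_def)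

lemma group_atoms:
  "(\<lambda>v. fun_interp N Plus [v i, v j] = v k) \<in> formula_predicates group_language N"
  "(\<lambda>v. v i = fun_interp N Zero []) \<in> formula_predicates group_language N"
  "(\<lambda>v. v i = fun_interp N One []) \<in> formula_predicates group_language N"
  unfolding formula_predicates_def mem_Collect_eq
    by (rule exI[of _ "Equal (Fun Plus [Var i, Var j]) (Var k)"],
        simp add: group_language_def padic_language_def)
      (rule exI[of _ "Equal (Var i) (Fun Zero [])"],
        simp add: group_language_def padic_language_def,
       rule exI[of _ "Equal (Var i) (Fun One [])"],
        simp add: group_language_def padic_language_def)

lemma universe_int [simp]: "universe (int_padic_struct p) = UNIV"
  by (simp add: int_padic_struct_def)

text \<open>The prime enters only through the relation symbol. This permits reading a group formula
  that defines \<open>|_p\<close> in the structure of another prime.\<close>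

lemma sat_int_padic_struct_group:
  "is_fm group_language \<phi> \<Longrightarrow> sat (int_padic_struct p) v \<phi> = sat (int_padic_struct q) v \<phi>"
proof (induction \<phi> arbitrary: v)
  case (Equal s t)
  have "tm_val (int_padic_struct p) v t = tm_val (int_padic_struct q) v t" for t
    by (induction t) (simp_all add: int_padic_struct_def cong: map_cong)
  then show ?case by simp
next
  case (Rel r ts)
  then show ?case by (simp add: group_language_def)
qed simp_all

context prime_base
begin

lemma is_struct_int: "is_struct padic_language (int_padic_struct p)"
  by (simp add: is_struct_def int_padic_struct_def)

lemma formula_predicates_int_subset:
  "formula_predicates padic_language (int_padic_struct p) \<subseteq> padic_class"
proof
  fix P assume "P \<in> formula_predicates padic_language (int_padic_struct p)"
  then obtain \<phi> where \<phi>: "is_fm padic_language \<phi>" "P = (\<lambda>v. sat (int_padic_struct p) v \<phi>)"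
    by (auto simp: formula_predicates_def)
  interpret PC: group_class padic_class by (rule group_class_padic_class)
  show "P \<in> padic_class"
    unfolding \<phi>(2)
  proof (rule PC.sat_mem[OF is_struct_int _ _ _ _ _ _ \<phi>(1)])
    show "(\<lambda>v. v i = fun_interp (int_padic_struct p) Zero []) \<in> padic_class" for i
      using PC.eq_terms[OF PC.dterm_var PC.dterm_zero] by (simp add: int_padic_struct_def)
  qed (simp_all add: int_padic_struct_def padic_class_val_le padic_class_plus padic_class_one)
qed

lemma group_class_formula_predicates_int:
  "group_class (formula_predicates group_language (int_padic_struct p))"
proof -
  interpret fo_class "UNIV :: int set" "formula_predicates group_language (int_padic_struct p)"
    using fo_class_formula_predicates[of "int_padic_struct p"] by simp
  show ?thesis
    using group_atoms[where N = "int_padic_struct p"]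
    by unfold_locales (simp_all add: int_padic_struct_def)
qed

end

lemma is_fm_iff_fm: "is_fm L (iff_fm \<phi> \<psi>) \<longleftrightarrow> is_fm L \<phi> \<and> is_fm L \<psi>"
  by auto

abbreviation "padic_dvd_fm \<equiv> Rel PDvd [Var 0, Var 1]"

lemma is_fm_padic_dvd: "is_fm padic_language padic_dvd_fm"
  by (simp add: padic_language_def)

section \<open>Transfer between the integers and N\<close>

lemma elementary_extension_iff_transfer:
  assumes "elementary_extension L M e N" "is_fm L \<phi>" "is_fm L \<psi>"
  shows "(\<forall>v. range v \<subseteq> universe M \<longrightarrow> sat M v \<phi> = sat M v \<psi>) \<longleftrightarrow>
    (\<forall>v. range v \<subseteq> universe N \<longrightarrow> sat N v \<phi> = sat N v \<psi>)"
  using elementary_extension_valid[OF assms(1), of "iff_fm \<phi> \<psi>"] assms(2,3)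
  by (simp only: is_fm_iff_fm valid_iff_fm)

lemma padic_not_group_definable:
  assumes p: "prime p" and e: "elementary_extension padic_language (int_padic_struct p) e N"
  shows "\<not> formula_predicates padic_language N \<subseteq> formula_predicates group_language N"
proof
  assume subset: "formula_predicates padic_language N \<subseteq> formula_predicates group_language N"
  have "(\<lambda>v. sat N v padic_dvd_fm) \<in> formula_predicates padic_language N"
    by (rule formula_predicatesI[OF is_fm_padic_dvd refl])
  with subset have "(\<lambda>v. sat N v padic_dvd_fm) \<in> formula_predicates group_language N" by blast
  then obtain \<gamma> where \<gamma>: "is_fm group_language \<gamma>"
    "\<And>v. range v \<subseteq> universe N \<Longrightarrow> sat N v padic_dvd_fm = sat N v \<gamma>"
    by (rule formula_predicatesE) blast
  have *: "sat (int_padic_struct p) v padic_dvd_fm = sat (int_padic_struct p) v \<gamma>" for v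
    using elementary_extension_iff_transfer[OF e is_fm_padic_dvd is_fm_group_imp_padic[OF \<gamma>(1)]] \<gamma>(2)
    by (simp del: sat.simps)
  define q :: nat where "q = (if p = 2 then 3 else 2)"
  have q: "prime q" "p \<noteq> q" by (auto simp: q_def)
  interpret q: prime_base q by unfold_locales fact
  have "sat (int_padic_struct q) v \<gamma> = (padic_val p (v 0) \<le> padic_val p (v 1))" for v
    using *[of v] sat_int_padic_struct_group[OF \<gamma>(1), of p v q] by (simp add: int_padic_struct_def)
  then have "(\<lambda>v. padic_val p (v 0) \<le> padic_val p (v 1)) \<in> formula_predicates padic_language (int_padic_struct q)"
    by (intro formula_predicatesI[OF is_fm_group_imp_padic[OF \<gamma>(1)]]) simp
  then show False
    using val_le_not_other_prime[OF p q] q.formula_predicates_int_subset by blast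
qed

lemma intermediate_class:
  assumes p: "prime p" and e: "elementary_extension padic_language (int_padic_struct p) e N"
    and E: "fo_class (universe N) E" "formula_predicates group_language N \<subseteq> E"
      "E \<subseteq> formula_predicates padic_language N"
  shows "formula_predicates padic_language N \<subseteq> E \<or> E \<subseteq> formula_predicates group_language N"
proof -
  interpret prime_base p by unfold_locales fact
  interpret E: fo_class "universe N" E by fact
  let ?Z = "int_padic_struct p"
  \<comment> \<open>A predicate in \<open>E\<close> is pulled back to the integers through a formula
    that defines it on \<open>N\<close>. By elementarity, formulas equivalent over the integers are
    equivalent over \<open>N\<close>, so membership does not depend on the formula chosen.\<close>
  define C where "C = {P. \<exists>\<phi>. is_fm padic_language \<phi> \<and> P = (\<lambda>v. sat ?Z v \<phi>) \<and> (\<lambda>v. sat N v \<phi>) \<in> E}"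
  have group_mem: "(\<lambda>v. sat ?Z v \<phi>) \<in> C" if "is_fm group_language \<phi>" for \<phi>
    using that is_fm_group_imp_padic[OF that] formula_predicatesI[OF that refl] E(2) unfolding C_def by blast
  have "group_class C"
  proof
    fix P Q assume P: "P \<in> C"
    then obtain \<phi> where \<phi>: "is_fm padic_language \<phi>" "P = (\<lambda>v. sat ?Z v \<phi>)" "(\<lambda>v. sat N v \<phi>) \<in> E"
      by (auto simp: C_def)
    show "Q \<in> C" if "\<And>v. range v \<subseteq> UNIV \<Longrightarrow> P v = Q v"
    proof -
      have "P = Q" using that by (intro ext) auto
      then show ?thesis using P by simp
    qed
    show "(\<lambda>v. \<not> P v) \<in> C"
      unfolding C_def using \<phi> E.neg[OF \<phi>(3)] by (intro CollectI exI[of _ "Neg \<phi>"]) simp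
    show "(\<lambda>v. \<exists>x\<in>UNIV. P (v(i := x))) \<in> C" for i
      unfolding C_def using \<phi> E.exi[OF \<phi>(3), of i] by (intro CollectI exI[of _ "Exi i \<phi>"]) simp
    show "\<exists>n. supported UNIV n P" unfolding \<phi>(2) by (rule supported_sat)
    show "(\<lambda>v. P v \<and> Q v) \<in> C" if Q: "Q \<in> C"
    proof -
      obtain \<psi> where \<psi>: "is_fm padic_language \<psi>" "Q = (\<lambda>v. sat ?Z v \<psi>)" "(\<lambda>v. sat N v \<psi>) \<in> E"
        using Q by (auto simp: C_def)
      show ?thesis
        unfolding C_def using \<phi> \<psi> E.conj[OF \<phi>(3) \<psi>(3)] by (intro CollectI exI[of _ "Conj \<phi> \<psi>"]) simp
    qed
  next
    show "(\<lambda>v. v i = v j) \<in> C" for i j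
      using group_mem[of "Equal (Var i) (Var j)"] by simp
    show "(\<lambda>v. v i + v j = v k) \<in> C" for i j k
      using group_mem[of "Equal (Fun Plus [Var i, Var j]) (Var k)"]
      by (simp add: group_language_def padic_language_def int_padic_struct_def)
    show "(\<lambda>v. v i = 1) \<in> C" for i
      using group_mem[of "Equal (Var i) (Fun One [])"]
      by (simp add: group_language_def padic_language_def int_padic_struct_def)
  qed
  moreover have "C \<subseteq> padic_class"
    using formula_predicates_int_subset unfolding C_def by (auto intro: formula_predicatesI)
  ultimately consider "(\<lambda>v. val (v 0) \<le> val (v 1)) \<in> C" | "C \<subseteq> formula_predicates group_language ?Z"
    using val_mem_or_subset[OF _ _ group_class_formula_predicates_int] by blast
  then show ?thesis
  proof cases
    case 1
    then obtain \<phi> where \<phi>: "is_fm padic_language \<phi>" "(\<lambda>v. val (v 0) \<le> val (v 1)) = (\<lambda>v. sat ?Z v \<phi>)"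
      "(\<lambda>v. sat N v \<phi>) \<in> E" by (auto simp: C_def)
    have "sat ?Z v \<phi> = sat ?Z v padic_dvd_fm" for v
      using fun_cong[OF \<phi>(2), of v] by (simp add: int_padic_struct_def)
    then have "sat N v \<phi> = sat N v padic_dvd_fm" if "range v \<subseteq> universe N" for v
      using elementary_extension_iff_transfer[OF e \<phi>(1) is_fm_padic_dvd] that by blast
    then have dvd01: "(\<lambda>v. rel_interp N PDvd [v 0, v 1]) \<in> E"
      by (intro E.on_ext[OF \<phi>(3)]) simp
    have dvd: "(\<lambda>v. rel_interp N PDvd [v i, v j]) \<in> E" for i j
    proof -
      \<comment> \<open>The variables 0 and 1 are first moved to fresh indices, so that
        \<open>i\<close> and \<open>j\<close> may coincide or be 0 or 1 themselves.\<close>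
      define a where "a = i + j + 2"
      have "(\<lambda>v. rel_interp N PDvd [v 0, v (Suc a)]) \<in> E"
        using E.subst_var[OF dvd01, of 1 "Suc a"] by simp
      from E.subst_var[OF this, of 0 a] have "(\<lambda>v. rel_interp N PDvd [v a, v (Suc a)]) \<in> E" by simp
      from E.subst_var[OF this, of a i] have "(\<lambda>v. rel_interp N PDvd [v i, v (Suc a)]) \<in> E" by simp
      from E.subst_var[OF this, of "Suc a" j] show ?thesis by (simp add: a_def)
    qed
    have N: "is_struct padic_language N" using e by (simp add: elementary_extension_def)
    have "formula_predicates padic_language N \<subseteq> E"
    proof
      fix P assume "P \<in> formula_predicates padic_language N"
      then obtain \<psi> where \<psi>: "is_fm padic_language \<psi>" "\<forall>v. range v \<subseteq> universe N \<longrightarrow> P v = sat N v \<psi>"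
        by (auto simp: formula_predicates_def)
      have "(\<lambda>v. sat N v \<psi>) \<in> E"
        using group_atoms[where N = N] E(2) dvd
        by (intro E.sat_mem[OF N _ _ _ _ _ _ \<psi>(1)]) auto
      then show "P \<in> E" by (rule E.on_ext) (simp add: \<psi>(2))
    qed
    then show ?thesis ..
  next
    case 2
    \<comment> \<open>A predicate of \<open>E\<close> goes down to the integers by its formula
      \<open>\<phi>\<close>, a group formula \<open>\<gamma>\<close> replaces \<open>\<phi>\<close>
      there, and their equivalence goes back up to \<open>N\<close>.\<close>
    have "E \<subseteq> formula_predicates group_language N"
    proof
      fix P assume P: "P \<in> E"
      then obtain \<phi> where \<phi>: "is_fm padic_language \<phi>" "\<forall>v. range v \<subseteq> universe N \<longrightarrow> P v = sat N v \<phi>"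
        using E(3) by (metis formula_predicatesE subsetD)
      have "(\<lambda>v. sat N v \<phi>) \<in> E" by (rule E.on_ext[OF P]) (simp add: \<phi>(2))
      then have "(\<lambda>v. sat ?Z v \<phi>) \<in> C" using \<phi>(1) by (auto simp: C_def)
      then have "(\<lambda>v. sat ?Z v \<phi>) \<in> formula_predicates group_language ?Z" using 2 by blast
      then obtain \<gamma> where \<gamma>: "is_fm group_language \<gamma>" "\<forall>v. range v \<subseteq> universe ?Z \<longrightarrow> sat ?Z v \<phi> = sat ?Z v \<gamma>"
        by (rule formula_predicatesE) blast
      then have "\<forall>v. range v \<subseteq> universe N \<longrightarrow> sat N v \<phi> = sat N v \<gamma>"
        using elementary_extension_iff_transfer[OF e \<phi>(1) is_fm_group_imp_padic[OF \<gamma>(1)]] by blast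
      then show "P \<in> formula_predicates group_language N"
        using \<gamma>(1) \<phi>(2) by (intro formula_predicatesI) auto
    qed
    then show ?thesis ..
  qed
qed

theorem theorem1p11:
  fixes p :: nat
    and N :: "(group_fun, padic_rel, 'a) struct"
    and e :: "int \<Rightarrow> 'a"
  assumes "prime p"
    and "elementary_extension padic_language (int_padic_struct p) e N"
  shows "(padic_language, N) \<in> proper_expansions {} group_language N \<and>
    (\<forall>(L, M) \<in> (proper_expansions {} group_language N
        :: (('f, 'r) language \<times> ('f, 'r, 'a) struct) set).
      \<not> is_proper_reduct {} L M padic_language N)"
proof (intro conjI ballI)
  have N: "is_struct padic_language N" "is_struct group_language N"
    using assms(2) by (simp_all add: elementary_extension_def is_struct_group_iff)
  show "(padic_language, N) \<in> proper_expansions {} group_language N"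
    using N formula_predicates_group_subset padic_not_group_definable[OF assms]
    by (simp add: proper_expansions_def is_proper_reduct_def is_reduct_empty_iff)
  fix LM assume LM: "LM \<in> (proper_expansions {} group_language N
        :: (('f, 'r) language \<times> ('f, 'r, 'a) struct) set)"
  obtain L M where LM_eq: "LM = (L, M)" by (cases LM)
  have "\<not> is_proper_reduct {} L M padic_language N"
  proof
    assume "is_proper_reduct {} L M padic_language N"
    then have M: "is_struct L M" "universe M = universe N"
      "formula_predicates L M \<subseteq> formula_predicates padic_language N"
      "\<not> formula_predicates padic_language N \<subseteq> formula_predicates L M"
      using N unfolding is_proper_reduct_def is_reduct_empty_iff by auto
    have "formula_predicates group_language N \<subseteq> formula_predicates L M"
      "\<not> formula_predicates L M \<subseteq> formula_predicates group_language N"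
      using LM N M(1,2) unfolding LM_eq proper_expansions_def is_proper_reduct_def is_reduct_empty_iff by auto
    moreover have "fo_class (universe N) (formula_predicates L M)"
      using fo_class_formula_predicates[of M L] M(2) by simp
    ultimately show False using intermediate_class[OF assms] M(3,4) by blast
  qed
  then show "case LM of (L, M) \<Rightarrow> \<not> is_proper_reduct {} L M padic_language N"
    by (simp add: LM_eq)
qed

end
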